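(* Let $(\lambda_n)_{n=1}^\infty$ be a nondecreasing sequence of integers with $1\le\lambda_n\le n$, and for $f\in L_1(\mathbb{I})$ let $$V_n^{(\lambda)}(f;x):=\frac1{\lambda_n+1}\sum_{k=n-\lambda_n}^nS_k(f;x)$$ be the de la Vallée Poussin means with respect to the Walsh--Paley system. (a) If $n=O(\lambda_n)$ as $n\to\infty$, then for every $f\in L_1(\mathbb{I})$ one has $V_n^{(\lambda)}(f;x)\to f(x)$ as $n\to\infty$ for almost every $x\in\mathbb{I}$. (b) If $n/\lambda_n\to\infty$ as $n\to\infty$, then there exists a function $f\in L_1(\mathbb{I})$ for which the sequence $\{V_n^{(\lambda)}(f;x)\}_{n=1}^\infty$ diverges at every $x\in\mathbb{I}$.
   Context: $\mathbb{I}=[0,1)$ with Lebesgue measure. For $n\in\mathbb{N}=\{0,1,2,\dots\}$ write $n=\sum_{j\ge0}\varepsilon_j(n)2^j$ with $\varepsilon_j(n)\in\{0,1\}$. Each $x\in\mathbb{I}$ is written $x=\sum_{j\ge0}x_j2^{-(j+1)}$, $x_j\in\{0,1\}$ (terminating expansion for dyadic rationals); $r_k(x)=(-1)^{x_k}$ and $w_n=\prod_{k\ge0}r_k^{\varepsilon_k(n)}$ is the Walsh--Paley system. For $f\in L_1(\mathbb{I})$, $\widehat f(k)=\int_{\mathbb{I}}fw_k$ and $S_n(f;x)=\sum_{k=0}^{n-1}\widehat f(k)w_k(x)$ (so $S_0=0$). *)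

theory Defs
  imports "HOL-Analysis.Analysis" "HOL-Library.Landau_Symbols"
begin

abbreviation unit_measure :: "real measure" where
  "unit_measure \<equiv> lebesgue_on {0..<1}"

text \<open>
  The \<open>k\<close>-th binary digit of \<open>x \<in> [0,1)\<close>, counted from \<open>k = 0\<close>.  Taking the floor selects the
  terminating expansion of a dyadic rational; see \<open>binary_digit_sums\<close> and
  \<open>binary_digit_terminating\<close> below.
\<close>

definition binary_digit :: "nat \<Rightarrow> real \<Rightarrow> nat" where
  "binary_digit k x = nat (\<lfloor>x * 2 ^ Suc k\<rfloor> mod 2)"

definition rademacher :: "nat \<Rightarrow> real \<Rightarrow> real" where
  "rademacher k x = (- 1) ^ binary_digit k x"

text \<open>
  For a natural number \<open>n\<close>, the binary digit \<open>\<epsilon>\<^sub>k(n)\<close> is 1 iff \<open>bit n k\<close> holds.  The product is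
  restricted to the finitely many \<open>k\<close> with \<open>\<epsilon>\<^sub>k(n) = 1\<close>, as all other factors are 1.
\<close>

definition walsh :: "nat \<Rightarrow> real \<Rightarrow> real" where
  "walsh n x = (\<Prod>k | bit n k. rademacher k x)"

definition walsh_coeff :: "(real \<Rightarrow> real) \<Rightarrow> nat \<Rightarrow> real" where
  "walsh_coeff f k = (\<integral>x. f x * walsh k x \<partial>unit_measure)"

definition walsh_partial_sum :: "nat \<Rightarrow> (real \<Rightarrow> real) \<Rightarrow> real \<Rightarrow> real" where
  "walsh_partial_sum n f x = (\<Sum>k<n. walsh_coeff f k * walsh k x)"

text \<open>
  The subtraction \<open>n - \<lambda> n\<close> is on natural numbers; it is only meaningful when \<open>\<lambda> n \<le> n\<close>.
\<close>

definition vallee_poussin_mean :: "(nat \<Rightarrow> nat) \<Rightarrow> nat \<Rightarrow> (real \<Rightarrow> real) \<Rightarrow> real \<Rightarrow> real" where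
  "vallee_poussin_mean lam n f x =
     1 / (real (lam n) + 1) * (\<Sum>k = n - lam n..n. walsh_partial_sum k f x)"

lemma finite_bits: "finite {k. bit (n::nat) k}"
proof (rule finite_subset)
  show "{k. bit n k} \<subseteq> {..<n}"
  proof
    fix k assume "k \<in> {k. bit n k}"
    then have "odd (n div 2 ^ k)" by (simp add: bit_iff_odd)
    then have "n div 2 ^ k \<noteq> 0" by (metis even_zero)
    then have "2 ^ k \<le> n" by (metis div_less not_less)
    moreover have "k < 2 ^ k" by simp
    ultimately show "k \<in> {..<n}" using less_le_trans by blast
  qed
qed simp

lemma binary_digit_partial_sum:
  assumes "x \<in> {0..<1}"
  shows "(\<Sum>k<n. real (binary_digit k x) / 2 ^ Suc k) = of_int \<lfloor>x * 2 ^ n\<rfloor> / 2 ^ n"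
proof (induction n)
  case 0
  have "\<lfloor>x\<rfloor> = 0" using assms by (simp add: floor_eq_iff)
  then show ?case by simp
next
  case (Suc n)
  have "\<lfloor>x * 2 ^ n\<rfloor> = \<lfloor>x * 2 ^ Suc n\<rfloor> div 2"
    using floor_divide_real_eq_div[of 2 "x * 2 ^ Suc n"] by (simp add: mult.commute)
  then have "\<lfloor>x * 2 ^ Suc n\<rfloor> = 2 * \<lfloor>x * 2 ^ n\<rfloor> + int (binary_digit n x)"
    by (simp add: binary_digit_def)
  then have "real_of_int \<lfloor>x * 2 ^ Suc n\<rfloor> = 2 * of_int \<lfloor>x * 2 ^ n\<rfloor> + real (binary_digit n x)"
    by simp
  with Suc.IH show ?case by (simp add: field_simps)
qed

lemma binary_digit_sums:
  assumes "x \<in> {0..<1}"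
  shows "(\<lambda>k. real (binary_digit k x) / 2 ^ Suc k) sums x"
  unfolding sums_def binary_digit_partial_sum[OF assms]
proof (rule tendsto_sandwich)
  have "x - (1/2) ^ n \<le> of_int \<lfloor>x * 2 ^ n\<rfloor> / 2 ^ n" for n
  proof -
    have "(x * 2 ^ n - 1) / 2 ^ n \<le> of_int \<lfloor>x * 2 ^ n\<rfloor> / 2 ^ n"
      by (intro divide_right_mono) (linarith, simp)
    then show ?thesis by (simp add: diff_divide_distrib power_divide)
  qed
  then show "\<forall>\<^sub>F n in sequentially. x - (1/2) ^ n \<le> of_int \<lfloor>x * 2 ^ n\<rfloor> / 2 ^ n" by simp
  have "of_int \<lfloor>x * 2 ^ n\<rfloor> \<le> x * 2 ^ n" for n by linarith
  then show "\<forall>\<^sub>F n in sequentially. of_int \<lfloor>x * 2 ^ n\<rfloor> / 2 ^ n \<le> x" by (simp add: field_simps)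
  have "(\<lambda>n. x - (1/2) ^ n) \<longlonglongrightarrow> x - 0"
    by (intro tendsto_diff tendsto_const LIMSEQ_power_zero) simp
  then show "(\<lambda>n. x - (1/2) ^ n) \<longlonglongrightarrow> x" by simp
qed simp

lemma binary_digit_terminating:
  assumes "x = real m / 2 ^ n" and "k \<ge> n"
  shows "binary_digit k x = 0"
proof -
  have "(2::real) ^ Suc k = 2 ^ n * (2 * 2 ^ (k - n))"
    using assms(2) by (simp flip: power_add)
  then have "x * 2 ^ Suc k = of_int (2 * (int m * 2 ^ (k - n)))"
    using assms(1) by simp
  then have "\<lfloor>x * 2 ^ Suc k\<rfloor> = 2 * (int m * 2 ^ (k - n))"
    by (metis floor_of_int)
  then show ?thesis by (simp add: binary_digit_def)
qed

end

theory Submission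
  imports Defs
begin

text \<open>
  Everything rests on one feature of the Walsh--Paley system: the Dirichlet kernel
  \<open>\<Sum>k<n. w\<^sub>k(x) w\<^sub>k(t)\<close> depends on \<open>x\<close> and \<open>t\<close> only through the signs \<open>r\<^sub>k(x) r\<^sub>k(t)\<close>,
  and it obeys the self-similarity \<open>dirichlet_add\<close>.  All kernel computations are therefore done
  for an arbitrary sequence of signs.

  Part (a).  The sum of \<open>S\<^sub>k\<close> over \<open>n - \<lambda>\<^sub>n \<le> k \<le> n\<close> is a difference of two sums of the form
  \<open>\<Sum>k<m. S\<^sub>k\<close>.  Since \<open>n = O(\<lambda>\<^sub>n)\<close>, it is enough that each of these is \<open>m f(x) + o(n)\<close> for almost
  every \<open>x\<close>, that is, that the Fejer means converge almost everywhere.  The Fejer kernel is at most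
  a sum over \<open>2 ^ a \<le> n\<close> of multiples of indicators of dyadic cells (\<open>fejer_bound\<close>): the cell
  of level \<open>a\<close> around \<open>x\<close> and the cells around the points obtained from \<open>x\<close> by changing one binary
  digit \<open>j < a\<close>, the latter with a factor \<open>2 ^ (j - a)\<close>.  So the means converge at every \<open>x\<close> at
  which the corresponding averages of \<open>\<bar>f - f(x)\<bar>\<close> tend to 0.  That almost every \<open>x\<close> is such a point
  follows from the density of continuous functions and the weak-type inequality
  \<open>flip_avg_weak_type\<close>, which is derived from the dyadic stopping times, transported by the measure
  preserving digit changes.

  Part (b).  If \<open>f\<close> depends only on the binary digits from the \<open>s\<close>-th on, then only multiples of
  \<open>2 ^ s\<close> occur in its Walsh spectrum, so \<open>S\<^sub>k f\<close> is constant for \<open>2 ^ s (q - 1) < k \<le> 2 ^ s q\<close>.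
  If moreover \<open>\<lambda>\<^sub>n < 2 ^ s\<close> for \<open>n = 2 ^ s q\<close>, then the mean \<open>V\<^sub>n f\<close> equals the partial sum \<open>S\<^sub>n f\<close>.
  Because \<open>n / \<lambda>\<^sub>n \<rightarrow> \<infinity>\<close>, this holds for all \<open>q\<close> up to any prescribed bound once \<open>s\<close> is large.
  The means along such \<open>n\<close> are thus partial sums, and averaging is of no help: a Kolmogorov-type
  construction (\<open>kolmogorov_block\<close>) gives nonnegative Walsh polynomials of integral 1 whose partial
  sums oscillate as much as desired at every point.  Dilating these by suitable powers of 2, so that
  their spectra lie in successive blocks, and summing them with weights \<open>2 ^ (-j)\<close> gives \<open>f\<close>.
\<close>

section \<open>Walsh products of a sign sequence and their kernels\<close>

text \<open>
  Taking \<open>r\<^sub>k(x)\<close>, \<open>r\<^sub>k(x) r\<^sub>k(t)\<close> or \<open>r\<^sub>k\<^sub>+\<^sub>s(x)\<close> for \<open>\<rho> k\<close> gives \<open>w\<^sub>n(x)\<close>, \<open>w\<^sub>n(x) w\<^sub>n(t)\<close> and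
  \<open>w\<^sub>m(x)\<close> with \<open>m = 2 ^ s n\<close>, respectively.
\<close>

definition wprod :: "(nat \<Rightarrow> real) \<Rightarrow> nat \<Rightarrow> real" where
  "wprod \<rho> n = (\<Prod>k | bit n k. \<rho> k)"

definition dirichlet :: "(nat \<Rightarrow> real) \<Rightarrow> nat \<Rightarrow> real" where
  "dirichlet \<rho> n = (\<Sum>k<n. wprod \<rho> k)"

text \<open>
  The Fejer kernel without the normalising factor \<open>1 / n\<close>, which keeps the recursions below free of
  divisions.
\<close>

definition fejer :: "(nat \<Rightarrow> real) \<Rightarrow> nat \<Rightarrow> real" where
  "fejer \<rho> n = (\<Sum>k<n. dirichlet \<rho> k)"

definition signs :: "(nat \<Rightarrow> real) \<Rightarrow> bool" where
  "signs \<rho> \<longleftrightarrow> (\<forall>k. \<rho> k = 1 \<or> \<rho> k = - 1)"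

lemma signsD: "signs \<rho> \<Longrightarrow> \<rho> k = 1 \<or> \<rho> k = - 1"
  by (simp add: signs_def)

lemma signs_mult: "signs \<rho> \<Longrightarrow> signs \<sigma> \<Longrightarrow> signs (\<lambda>k. \<rho> k * \<sigma> k)"
  unfolding signs_def by (metis mult_1 mult_minus1 minus_minus)

lemma wprod_0 [simp]: "wprod \<rho> 0 = 1"
  by (simp add: wprod_def)

lemma wprod_mult: "wprod (\<lambda>k. \<rho> k * \<sigma> k) n = wprod \<rho> n * wprod \<sigma> n"
  by (simp add: wprod_def prod.distrib)

lemma wprod_sign: "signs \<rho> \<Longrightarrow> wprod \<rho> n = 1 \<or> wprod \<rho> n = - 1"
proof -
  assume "signs \<rho>"
  then have "\<bar>wprod \<rho> n\<bar> = 1"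
    unfolding wprod_def abs_prod signs_def by (intro prod.neutral) (metis abs_1 abs_minus)
  then show ?thesis by linarith
qed


lemma bit_multiple_pow2: "2 ^ a dvd (h::nat) \<Longrightarrow> bit h k \<Longrightarrow> a \<le> k"
  by (metis bit_take_bit_iff take_bit_eq_0_iff bit_0_eq not_less bot_apply bot_bool_def)

lemma bit_below_pow2: "l < (2::nat) ^ a \<Longrightarrow> bit l k \<Longrightarrow> k < a"
  by (metis bit_take_bit_iff take_bit_nat_eq_self)

text \<open>
  The binary digits of \<open>h\<close> and \<open>l\<close> occupy disjoint positions, so adding the numbers unites the digit
  sets.
\<close>

lemma wprod_add:
  assumes "2 ^ a dvd h" and "l < (2::nat) ^ a"
  shows "wprod \<rho> (h + l) = wprod \<rho> h * wprod \<rho> l"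
proof -
  have disj: "\<not> (bit h k \<and> bit l k)" for k
    using bit_multiple_pow2[OF assms(1)] bit_below_pow2[OF assms(2)] by (meson not_less)
  then have "h + l = or h l"
    by (intro disjunctive_add_eq_or) (auto simp: bit_eq_iff bit_simps)
  then have "{k. bit (h + l) k} = {k. bit h k} \<union> {k. bit l k}"
    by (auto simp: bit_simps)
  then show ?thesis
    using disj unfolding wprod_def by (subst prod.union_disjoint[symmetric]) (auto simp: finite_bits)
qed

lemma wprod_pow2 [simp]: "wprod \<rho> (2 ^ a) = \<rho> a"
proof -
  have "{k. bit ((2::nat) ^ a) k} = {a}" by (auto simp: bit_exp_iff)
  then show ?thesis by (simp add: wprod_def)
qed

lemma dirichlet_0 [simp]: "dirichlet \<rho> 0 = 0"
  by (simp add: dirichlet_def)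

lemma dirichlet_Suc: "dirichlet \<rho> (Suc n) = dirichlet \<rho> n + wprod \<rho> n"
  by (simp add: dirichlet_def)

text \<open>
  The self-similarity of the system: multiplication by \<open>w\<^sub>h\<close> carries the first \<open>2 ^ a\<close> functions to
  those with indices from \<open>h\<close> on.  This identity yields the upper bounds for the Fejer kernel, the
  lower bounds for the Dirichlet kernel, and the choice of signs in \<open>kolmogorov_block\<close>.
\<close>

lemma dirichlet_add:
  assumes "2 ^ a dvd h" and "l \<le> (2::nat) ^ a"
  shows "dirichlet \<rho> (h + l) = dirichlet \<rho> h + wprod \<rho> h * dirichlet \<rho> l"
  using assms(2)
proof (induction l)
  case (Suc l)
  then show ?case
    using wprod_add[OF assms(1), of l] by (simp add: dirichlet_Suc distrib_left)
qed simp

lemma dirichlet_pow2: "dirichlet \<rho> (2 ^ a) = (\<Prod>k<a. 1 + \<rho> k)"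
proof (induction a)
  case 0
  then show ?case by (simp add: dirichlet_def)
next
  case (Suc a)
  then show ?case
    using dirichlet_add[of a "2 ^ a" "2 ^ a" \<rho>] by (simp add: mult_2 algebra_simps)
qed

lemma dirichlet_pow2_signs:
  assumes "signs \<rho>"
  shows "dirichlet \<rho> (2 ^ a) = (if \<forall>k<a. \<rho> k = 1 then 2 ^ a else 0)"
proof (cases "\<forall>k<a. \<rho> k = 1")
  case False
  then obtain k where "k < a" "\<rho> k = - 1" using signsD[OF assms] by blast
  then have "(\<Prod>k<a. 1 + \<rho> k) = 0" by (intro prod_zero) (auto intro!: bexI[of _ k])
  then show ?thesis using False by (simp only: dirichlet_pow2 if_False)
qed (simp add: dirichlet_pow2)

lemma dirichlet_all_ones:
  assumes "\<forall>k<a. \<rho> k = 1" and "n \<le> 2 ^ a"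
  shows "dirichlet \<rho> n = real n"
proof -
  have "wprod \<rho> k = 1" if "k < n" for k
    unfolding wprod_def using assms that
    by (intro prod.neutral) (metis bit_below_pow2 less_le_trans mem_Collect_eq)
  then show ?thesis by (simp add: dirichlet_def)
qed

lemma fejer_0 [simp]: "fejer \<rho> 0 = 0"
  by (simp add: fejer_def)

lemma fejer_Suc: "fejer \<rho> (Suc n) = fejer \<rho> n + dirichlet \<rho> n"
  by (simp add: fejer_def)

lemma fejer_pow2_add:
  assumes "m \<le> 2 ^ a"
  shows "fejer \<rho> (2 ^ a + m) = fejer \<rho> (2 ^ a) + real m * dirichlet \<rho> (2 ^ a) + \<rho> a * fejer \<rho> m"
  using assms
proof (induction m)
  case (Suc m)
  then show ?case
    using dirichlet_add[of a "2 ^ a" m \<rho>] by (simp add: fejer_Suc algebra_simps)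
qed simp

lemma fejer_pow2_Suc:
  "fejer \<rho> (2 ^ Suc a) = (1 + \<rho> a) * fejer \<rho> (2 ^ a) + 2 ^ a * dirichlet \<rho> (2 ^ a)"
  using fejer_pow2_add[of "2 ^ a" a \<rho>] by (simp add: mult_2 algebra_simps)

lemma fejer_pow2_nonneg: "signs \<rho> \<Longrightarrow> 0 \<le> fejer \<rho> (2 ^ a)"
proof (induction a)
  case 0
  then show ?case by (simp add: fejer_def)
next
  case (Suc a)
  then show ?case
    using signsD[of \<rho> a] by (auto simp: fejer_pow2_Suc dirichlet_pow2_signs simp del: power_Suc)
qed

text \<open>
  Removing the leading binary digit \<open>2 ^ A\<close> of \<open>n\<close> by \<open>fejer_pow2_add\<close> leaves, up to sign, the kernel
  for the remaining digits; so only kernels whose order is a power of 2 occur.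
\<close>

lemma fejer_le_sum_pow2:
  assumes "signs \<rho>" and "n < 2 ^ A"
  shows "\<bar>fejer \<rho> n\<bar> \<le> (\<Sum>a<A. fejer \<rho> (2 ^ a) + 2 ^ a * dirichlet \<rho> (2 ^ a))"
  using assms(2)
proof (induction A arbitrary: n)
  case (Suc A)
  have top: "0 \<le> fejer \<rho> (2 ^ A) + 2 ^ A * dirichlet \<rho> (2 ^ A)"
    using fejer_pow2_nonneg[OF assms(1)] by (simp add: dirichlet_pow2_signs[OF assms(1)])
  show ?case
  proof (cases "n < 2 ^ A")
    case True
    then show ?thesis using Suc.IH[of n] top by simp
  next
    case False
    define m where "m = n - 2 ^ A"
    have m: "n = 2 ^ A + m" "m < 2 ^ A" using False Suc.prems by (auto simp: m_def)
    have "real m \<le> 2 ^ A" using m(2) by (metis less_imp_le of_nat_le_iff of_nat_numeral of_nat_power)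
    then have "real m * dirichlet \<rho> (2 ^ A) \<le> 2 ^ A * dirichlet \<rho> (2 ^ A)"
      by (intro mult_right_mono) (simp_all add: dirichlet_pow2_signs[OF assms(1)])
    moreover have "0 \<le> real m * dirichlet \<rho> (2 ^ A)"
      by (simp add: dirichlet_pow2_signs[OF assms(1)])
    moreover have "\<bar>\<rho> A * fejer \<rho> m\<bar> = \<bar>fejer \<rho> m\<bar>"
      using signsD[OF assms(1), of A] by auto
    moreover have "fejer \<rho> n = fejer \<rho> (2 ^ A) + real m * dirichlet \<rho> (2 ^ A) + \<rho> A * fejer \<rho> m"
      using fejer_pow2_add[of m A \<rho>] m by simp
    ultimately show ?thesis
      using Suc.IH[OF m(2)] fejer_pow2_nonneg[OF assms(1), of A]
      unfolding sum.lessThan_Suc by linarith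
  qed
qed simp

text \<open>
  For \<open>\<rho> k = r\<^sub>k(x) r\<^sub>k(t)\<close> this says that the first \<open>a\<close> binary digits of \<open>t\<close> are those of \<open>x\<close> with
  digit \<open>j\<close> changed.  For \<open>j \<ge> a\<close> it says that these digits agree; the case \<open>j = a\<close> makes the
  undisturbed cell part of the same family.
\<close>

definition single_flip :: "(nat \<Rightarrow> real) \<Rightarrow> nat \<Rightarrow> nat \<Rightarrow> bool" where
  "single_flip \<rho> a j \<longleftrightarrow> (\<forall>k<a. \<rho> k = (if k = j then - 1 else 1))"

text \<open>
  By the recursion \<open>fejer_pow2_Suc\<close>, a sign \<open>-1\<close> at position \<open>j\<close> turns the kernel into \<open>4 ^ j\<close> if all
  earlier signs are 1.  From then on, each sign 1 doubles it and a second sign \<open>-1\<close> annihilates it, so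
  that its order at level \<open>a\<close> is \<open>2 ^ (a + j)\<close>, much less than the peak \<open>4 ^ a\<close> if the changed digit
  \<open>j\<close> is coarse.
\<close>

lemma fejer_pow2_le:
  assumes "signs \<rho>"
  shows "fejer \<rho> (2 ^ a) \<le> (\<Sum>j\<le>a. 2 ^ (a + j) * of_bool (single_flip \<rho> a j))"
proof (induction a)
  case 0
  then show ?case by (simp add: fejer_def)
next
  case (Suc a)
  have ones: "(\<forall>k<a. \<rho> k = 1) \<longleftrightarrow> single_flip \<rho> a a" by (auto simp: single_flip_def)
  from signsD[OF assms, of a] show ?case
  proof
    assume r: "\<rho> a = - 1"
    have "fejer \<rho> (2 ^ Suc a) = 2 ^ (a + a) * of_bool (single_flip \<rho> a a)"
      unfolding fejer_pow2_Suc using r ones by (simp add: dirichlet_pow2_signs[OF assms] power_add)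
    also have "\<dots> \<le> 2 ^ (Suc a + a) * of_bool (single_flip \<rho> (Suc a) a)"
      using r by (auto simp: single_flip_def less_Suc_eq)
    also have "\<dots> \<le> (\<Sum>j\<le>Suc a. 2 ^ (Suc a + j) * of_bool (single_flip \<rho> (Suc a) j))"
      by (rule member_le_sum) auto
    finally show ?thesis .
  next
    assume r: "\<rho> a = 1"
    have low: "single_flip \<rho> (Suc a) j \<longleftrightarrow> single_flip \<rho> a j" if "j < a" for j
      using r that by (auto simp: single_flip_def less_Suc_eq)
    have hi: "single_flip \<rho> (Suc a) (Suc a) \<longleftrightarrow> single_flip \<rho> a a" "\<not> single_flip \<rho> (Suc a) a"
      using r by (auto simp: single_flip_def less_Suc_eq)
    have "fejer \<rho> (2 ^ Suc a) = 2 * fejer \<rho> (2 ^ a) + 2 ^ (a + a) * of_bool (single_flip \<rho> a a)"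
      unfolding fejer_pow2_Suc using r ones by (simp add: dirichlet_pow2_signs[OF assms] power_add)
    also have "\<dots> \<le> 2 * (\<Sum>j\<le>a. 2 ^ (a + j) * of_bool (single_flip \<rho> a j))
        + 2 ^ (a + a) * of_bool (single_flip \<rho> a a)"
      using Suc.IH by simp
    also have "\<dots> = (\<Sum>j<a. 2 ^ (Suc a + j) * of_bool (single_flip \<rho> a j))
        + 3 * 2 ^ (a + a) * of_bool (single_flip \<rho> a a)"
      by (simp add: lessThan_Suc_atMost[symmetric] sum_distrib_left algebra_simps
          del: sum_mult_of_bool_eq sum_of_bool_mult_eq)
    also have "\<dots> \<le> (\<Sum>j<a. 2 ^ (Suc a + j) * of_bool (single_flip \<rho> (Suc a) j))
        + 2 ^ (Suc a + Suc a) * of_bool (single_flip \<rho> (Suc a) (Suc a))"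
      using low hi by (intro add_mono sum_mono) auto
    also have "\<dots> = (\<Sum>j\<le>Suc a. 2 ^ (Suc a + j) * of_bool (single_flip \<rho> (Suc a) j))"
      using hi by (simp add: lessThan_Suc_atMost[symmetric])
    finally show ?thesis .
  qed
qed

lemma fejer_bound:
  assumes "signs \<rho>" and "n < 2 ^ A"
  shows "\<bar>fejer \<rho> n\<bar> \<le> (\<Sum>a<A. \<Sum>j\<le>a. 2 * 2 ^ (a + j) * of_bool (single_flip \<rho> a j))"
proof -
  have "fejer \<rho> (2 ^ a) + 2 ^ a * dirichlet \<rho> (2 ^ a)
      \<le> (\<Sum>j\<le>a. 2 * 2 ^ (a + j) * of_bool (single_flip \<rho> a j))" for a
  proof -
    have "2 ^ a * dirichlet \<rho> (2 ^ a) = 2 ^ (a + a) * of_bool (single_flip \<rho> a a)"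
      by (simp add: dirichlet_pow2_signs[OF assms(1)] single_flip_def power_add)
    also have "\<dots> \<le> (\<Sum>j\<le>a. 2 ^ (a + j) * of_bool (single_flip \<rho> a j))"
      by (rule member_le_sum) auto
    finally have "fejer \<rho> (2 ^ a) + 2 ^ a * dirichlet \<rho> (2 ^ a)
        \<le> 2 * (\<Sum>j\<le>a. 2 ^ (a + j) * of_bool (single_flip \<rho> a j))"
      using fejer_pow2_le[OF assms(1), of a] by linarith
    then show ?thesis by (simp only: sum_distrib_left mult.assoc)
  qed
  then show ?thesis
    by (intro order_trans[OF fejer_le_sum_pow2[OF assms]] sum_mono) auto
qed

section \<open>Dyadic cells and digit flips\<close>

lemma binary_digit_cases: "binary_digit k x = 0 \<or> binary_digit k x = 1"
  unfolding binary_digit_def by linarith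

lemma signs_rademacher: "signs (\<lambda>k. rademacher k x)"
  unfolding signs_def rademacher_def using binary_digit_cases by (metis power_0 power_one_right)

lemma rademacher_cases: "rademacher k x = 1 \<or> rademacher k x = - 1"
  using signs_rademacher by (rule signsD)

lemma rademacher_eq_iff: "rademacher k x = rademacher k y \<longleftrightarrow> binary_digit k x = binary_digit k y"
  unfolding rademacher_def using binary_digit_cases[of k x] binary_digit_cases[of k y] by auto

lemma walsh_eq_wprod: "walsh n x = wprod (\<lambda>k. rademacher k x) n"
  by (simp add: walsh_def wprod_def)

lemma floor_mult_pow2_div:
  fixes x :: real
  assumes "k \<le> a"
  shows "\<lfloor>x * 2 ^ k\<rfloor> = \<lfloor>x * 2 ^ a\<rfloor> div 2 ^ (a - k)"
proof -
  have "(2::real) ^ a = 2 ^ k * 2 ^ (a - k)" using assms by (simp flip: power_add)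
  then have "x * 2 ^ a / 2 ^ (a - k) = x * 2 ^ k" by simp
  then show ?thesis
    using floor_divide_real_eq_div[of "2 ^ (a - k)" "x * 2 ^ a"] by simp
qed

definition cell :: "nat \<Rightarrow> real \<Rightarrow> real set" where
  "cell a x = {t \<in> {0..<1}. \<forall>k<a. rademacher k t = rademacher k x}"

lemma mem_cell_iff_floor:
  assumes "x \<in> {0..<1}" and "t \<in> {0..<1}"
  shows "t \<in> cell a x \<longleftrightarrow> \<lfloor>t * 2 ^ a\<rfloor> = \<lfloor>x * 2 ^ a\<rfloor>"
proof
  assume "t \<in> cell a x"
  then have "(\<Sum>k<a. real (binary_digit k t) / 2 ^ Suc k) = (\<Sum>k<a. real (binary_digit k x) / 2 ^ Suc k)"
    by (intro sum.cong) (auto simp: cell_def rademacher_eq_iff)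
  then show "\<lfloor>t * 2 ^ a\<rfloor> = \<lfloor>x * 2 ^ a\<rfloor>"
    using binary_digit_partial_sum[OF assms(1), of a] binary_digit_partial_sum[OF assms(2), of a]
    by (metis divide_cancel_right of_int_eq_iff power_not_zero zero_neq_numeral)
next
  assume eq: "\<lfloor>t * 2 ^ a\<rfloor> = \<lfloor>x * 2 ^ a\<rfloor>"
  have "\<lfloor>t * 2 ^ Suc k\<rfloor> = \<lfloor>x * 2 ^ Suc k\<rfloor>" if "k < a" for k
    using that eq by (simp only: floor_mult_pow2_div[of "Suc k" a] Suc_leI)
  then show "t \<in> cell a x"
    using assms by (simp add: cell_def rademacher_def binary_digit_def)
qed

lemma cell_self: "x \<in> {0..<1} \<Longrightarrow> x \<in> cell a x"
  by (simp add: cell_def)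

lemma cell_subset_unit: "cell a x \<subseteq> {0..<1}"
  by (auto simp: cell_def)

lemma cell_cong: "y \<in> cell a x \<Longrightarrow> cell a y = cell a x"
  by (auto simp: cell_def)

lemma cell_mono: "a \<le> b \<Longrightarrow> cell b x \<subseteq> cell a x"
  by (auto simp: cell_def)

lemma floor_mult_pow2_range:
  assumes "x \<in> {0..<1::real}"
  shows "0 \<le> \<lfloor>x * 2 ^ a\<rfloor>" and "\<lfloor>x * 2 ^ a\<rfloor> < 2 ^ a"
proof -
  show "0 \<le> \<lfloor>x * 2 ^ a\<rfloor>" using assms by simp
  have "x * 2 ^ a < 2 ^ a" using assms by simp
  then show "\<lfloor>x * 2 ^ a\<rfloor> < 2 ^ a" by (simp add: floor_less_iff)
qed

lemma cell_eq_interval: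
  assumes "x \<in> {0..<1}"
  shows "cell a x = {of_int \<lfloor>x * 2 ^ a\<rfloor> / 2 ^ a..<(of_int \<lfloor>x * 2 ^ a\<rfloor> + 1) / 2 ^ a}"
proof -
  let ?p = "\<lfloor>x * 2 ^ a\<rfloor>"
  have iff: "\<lfloor>t * 2 ^ a\<rfloor> = ?p \<longleftrightarrow> of_int ?p / 2 ^ a \<le> t \<and> t < (of_int ?p + 1) / 2 ^ a" for t :: real
    by (subst floor_eq_iff) (simp add: field_simps)
  have "of_int (?p + 1) \<le> (2::real) ^ a"
    using floor_mult_pow2_range(2)[OF assms, of a] by (metis of_int_le_iff of_int_numeral of_int_power zless_imp_add1_zle)
  then have "(of_int ?p + 1) / 2 ^ a \<le> (1::real)" by (simp add: field_simps)
  moreover have "0 \<le> of_int ?p / (2::real) ^ a"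
    using floor_mult_pow2_range(1)[OF assms, of a] by simp
  ultimately have "t \<in> {0..<1}" if "\<lfloor>t * 2 ^ a\<rfloor> = ?p" for t :: real
    using that unfolding iff atLeastLessThan_iff by linarith
  then show ?thesis
    using mem_cell_iff_floor[OF assms] cell_subset_unit[of a x] by (auto simp: iff[symmetric])
qed

lemma cell_measurable: "x \<in> {0..<1} \<Longrightarrow> cell a x \<in> sets unit_measure"
  by (simp add: sets_restrict_space_iff cell_subset_unit) (simp add: cell_eq_interval)

lemma measure_cell: "x \<in> {0..<1} \<Longrightarrow> measure unit_measure (cell a x) = 1 / 2 ^ a"
  using cell_subset_unit[of a x]
  by (simp add: measure_restrict_space) (simp add: cell_eq_interval field_simps)

text \<open>
  Changes the binary digit \<open>j\<close>: the sign \<open>r\<^sub>j(x)\<close> is \<open>1\<close> if the digit is 0, and \<open>-1\<close> if it is 1.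
\<close>

definition flip :: "nat \<Rightarrow> real \<Rightarrow> real" where
  "flip j x = x + rademacher j x / 2 ^ Suc j"

lemma flip_digits:
  assumes "x \<in> {0..<1}"
  shows "flip j x \<in> {0..<1}"
    and "rademacher k (flip j x) = (if k = j then - rademacher k x else rademacher k x)"
proof -
  define n where "n = \<lfloor>x * 2 ^ Suc j\<rfloor>"
  define s :: int where "s = (if even n then 1 else - 1)"
  have r: "rademacher j x = of_int s"
    unfolding rademacher_def binary_digit_def n_def[symmetric] s_def
    by (cases "even n") (auto elim!: evenE oddE)
  have fl: "flip j x * 2 ^ Suc j = x * 2 ^ Suc j + of_int s"
    by (simp add: flip_def r field_simps)
  have n': "\<lfloor>flip j x * 2 ^ Suc j\<rfloor> = n + s"
    unfolding fl n_def by simp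
  \<comment> \<open>the flip exchanges 2 p and 2 p + 1, which leaves the coarser floors unchanged\<close>
  have half: "(n + s) div 2 = n div 2"
    unfolding s_def by (cases "even n") (auto elim!: evenE oddE)
  have low: "\<lfloor>flip j x * 2 ^ k\<rfloor> = \<lfloor>x * 2 ^ k\<rfloor>" if "k \<le> j" for k
  proof -
    have "\<lfloor>y * 2 ^ k\<rfloor> = (\<lfloor>y * 2 ^ Suc j\<rfloor> div 2) div 2 ^ (j - k)" for y :: real
      using floor_mult_pow2_div[of k "Suc j" y] that
      by (simp add: Suc_diff_le zdiv_zmult2_eq)
    then show ?thesis using half n' unfolding n_def by simp
  qed
  have "\<lfloor>flip j x\<rfloor> = 0" using low[of 0] assms floor_eq_iff[of x 0] by simp
  then show "flip j x \<in> {0..<1}" by (simp add: floor_eq_iff)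
  consider "k < j" | "k = j" | "k > j" by linarith
  then show "rademacher k (flip j x) = (if k = j then - rademacher k x else rademacher k x)"
  proof cases
    case 1
    then show ?thesis using low[of "Suc k"] by (simp add: rademacher_def binary_digit_def)
  next
    case 2
    have "rademacher j (flip j x) = - of_int s"
      unfolding rademacher_def binary_digit_def n' unfolding s_def
      by (cases "even n") (auto elim!: evenE oddE)
    then show ?thesis using 2 r by simp
  next
    case 3
    have "(2::real) ^ Suc k = 2 ^ Suc j * 2 ^ (k - j)" using 3 by (simp flip: power_add)
    then have "flip j x * 2 ^ Suc k = (flip j x * 2 ^ Suc j) * 2 ^ (k - j)"
      and "x * 2 ^ Suc k = (x * 2 ^ Suc j) * 2 ^ (k - j)" by simp_all
    then have "flip j x * 2 ^ Suc k = x * 2 ^ Suc k + of_int (s * 2 ^ (k - j))"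
      unfolding fl by (simp only: distrib_right of_int_mult of_int_power of_int_numeral)
    then have "\<lfloor>flip j x * 2 ^ Suc k\<rfloor> = \<lfloor>x * 2 ^ Suc k\<rfloor> + s * 2 ^ (k - j)"
      by (simp only: floor_add_int)
    moreover have "(s * 2 ^ (k - j)) mod 2 = 0" using 3 by (simp add: mod_eq_0_iff_dvd)
    ultimately have "\<lfloor>flip j x * 2 ^ Suc k\<rfloor> mod 2 = \<lfloor>x * 2 ^ Suc k\<rfloor> mod 2"
      by (metis add.right_neutral mod_add_right_eq)
    then show ?thesis using 3 by (simp add: rademacher_def binary_digit_def)
  qed
qed

lemma flip_flip: "x \<in> {0..<1} \<Longrightarrow> flip j (flip j x) = x"
  using flip_digits(2)[of x j j] by (simp add: flip_def[of j "flip j x"]) (simp add: flip_def)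

lemma cell_flip: "a \<le> j \<Longrightarrow> x \<in> {0..<1} \<Longrightarrow> cell a (flip j x) = cell a x"
  by (auto simp: cell_def flip_digits(2))

lemma mem_cell_flip_iff:
  assumes "x \<in> {0..<1}" and "t \<in> {0..<1}"
  shows "t \<in> cell a (flip j x) \<longleftrightarrow> single_flip (\<lambda>k. rademacher k x * rademacher k t) a j"
proof -
  have "rademacher k t = rademacher k (flip j x) \<longleftrightarrow>
      rademacher k x * rademacher k t = (if k = j then - 1 else 1)" for k
    unfolding flip_digits(2)[OF assms(1)]
    using rademacher_cases[of k x] rademacher_cases[of k t] by auto
  then show ?thesis using assms(2) by (simp add: cell_def single_flip_def)
qed

lemma space_unit [simp]: "space unit_measure = {0..<1}"
  by simp

lemma measurable_floor_fun [measurable]: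
  "(\<lambda>x::real. F \<lfloor>x * 2 ^ a\<rfloor> :: real) \<in> borel_measurable borel"
  by measurable

lemma rademacher_measurable [measurable]: "rademacher k \<in> borel_measurable borel"
  unfolding rademacher_def[abs_def] binary_digit_def by measurable

lemma walsh_measurable_borel [measurable]: "walsh k \<in> borel_measurable borel"
  unfolding walsh_def[abs_def] by measurable

lemma borel_imp_unit_measurable: "h \<in> borel_measurable borel \<Longrightarrow> h \<in> borel_measurable unit_measure"
  by (simp add: measurable_completion measurable_restrict_space1)

lemma prob_unit: "emeasure unit_measure {0..<1} = 1" "finite_measure unit_measure"
proof -
  show *: "emeasure unit_measure {0..<1} = 1" by (simp add: emeasure_restrict_space)
  show "finite_measure unit_measure" by (rule finite_measureI) (use * in simp)
qed

text \<open>
  The flip acts as a translation on each of the two sets on which \<open>r\<^sub>j\<close> is constant, and exchanges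
  them.  The right-hand side makes the translation invariance of Lebesgue measure applicable.
\<close>

lemma flip_vimage:
  assumes "A \<subseteq> {0..<1}"
  shows "flip j -` A \<inter> {0..<1} =
      ((+) (- 1 / 2 ^ Suc j)) ` (A \<inter> {x. rademacher j x = - 1}) \<union>
      ((+) (1 / 2 ^ Suc j)) ` (A \<inter> {x. rademacher j x = 1})" (is "?L = ?R")
proof
  show "?L \<subseteq> ?R"
  proof
    fix x assume x: "x \<in> ?L"
    then have x': "x \<in> {0..<1}" "flip j x \<in> A" by auto
    have r: "rademacher j (flip j x) = - rademacher j x" using flip_digits(2)[OF x'(1), of j j] by simp
    from rademacher_cases[of j x] show "x \<in> ?R"
    proof
      assume "rademacher j x = 1"
      then have "flip j x \<in> A \<inter> {x. rademacher j x = - 1}" "x = - 1 / 2 ^ Suc j + flip j x"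
        using x' r by (auto simp: flip_def)
      then show ?thesis by blast
    next
      assume "rademacher j x = - 1"
      then have "flip j x \<in> A \<inter> {x. rademacher j x = 1}" "x = 1 / 2 ^ Suc j + flip j x"
        using x' r by (auto simp: flip_def)
      then show ?thesis by blast
    qed
  qed
  show "?R \<subseteq> ?L"
  proof
    fix x assume "x \<in> ?R"
    then obtain y where y: "y \<in> A" "x = flip j y"
      by (auto simp: flip_def)
    then show "x \<in> ?L" using assms flip_digits(1)[of y j] flip_flip[of y j] by auto
  qed
qed

lemma lebesgue_rademacher_set: "{x. rademacher j x = c} \<in> sets lebesgue"
proof -
  have "{x \<in> space borel. rademacher j x = c} \<in> sets borel" by measurable
  then show ?thesis by simp
qed

lemma flip_measurable: "flip j \<in> unit_measure \<rightarrow>\<^sub>M unit_measure"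
proof (rule measurableI)
  show "flip j x \<in> space unit_measure" if "x \<in> space unit_measure" for x
    using that flip_digits(1) by simp
  fix A assume "A \<in> sets unit_measure"
  then have A: "A \<subseteq> {0..<1}" "A \<in> sets lebesgue" by (auto simp: sets_restrict_space_iff)
  have "flip j -` A \<inter> {0..<1} \<in> sets lebesgue"
    unfolding flip_vimage[OF A(1)] using A(2) lebesgue_rademacher_set
    by (intro sets.Un lebesgue_sets_translation sets.Int) auto
  then show "flip j -` A \<inter> space unit_measure \<in> sets unit_measure"
    by (simp add: sets_restrict_space_iff)
qed

lemma measure_flip_vimage:
  assumes "A \<in> sets unit_measure"
  shows "measure unit_measure (flip j -` A \<inter> {0..<1}) = measure unit_measure A"
proof -
  have A: "A \<subseteq> {0..<1}" "A \<in> sets lebesgue" using assms by (auto simp: sets_restrict_space_iff)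
  have fm: "B \<in> lmeasurable" if "B \<subseteq> {0..<1}" "B \<in> sets lebesgue" for B :: "real set"
    using that by (intro bounded_set_imp_lmeasurable bounded_subset[OF bounded_closed_interval[of 0 1]]) auto
  have Un: "measure lebesgue (B \<union> C) = measure lebesgue B + measure lebesgue C"
    if "B \<in> lmeasurable" "C \<in> lmeasurable" "B \<inter> C = {}" for B C :: "real set"
    using that by (metis measure_Union fmeasurableD fmeasurableD2 infinity_ennreal_def)
  define Am where "Am = A \<inter> {x. rademacher j x = - 1}"
  define Ap where "Ap = A \<inter> {x. rademacher j x = 1}"
  have S: "Am \<in> lmeasurable" "Ap \<in> lmeasurable"
    unfolding Am_def Ap_def using A by (blast intro: fm sets.Int lebesgue_rademacher_set)+
  have disj: "((+) (- 1 / 2 ^ Suc j)) ` Am \<inter> ((+) (1 / 2 ^ Suc j)) ` Ap = {}"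
  proof -
    have False if "- 1 / 2 ^ Suc j + y = 1 / 2 ^ Suc j + z" "y \<in> Am" "z \<in> Ap" for y z
    proof -
      have "flip j y = flip j z" using that by (simp add: flip_def Am_def Ap_def)
      moreover have "y \<in> {0..<1}" "z \<in> {0..<1}" using that A(1) by (auto simp: Am_def Ap_def)
      ultimately have "y = z" by (metis flip_flip)
      then show False using that by (auto simp: Am_def Ap_def)
    qed
    then show ?thesis by blast
  qed
  have "measure unit_measure (flip j -` A \<inter> {0..<1}) = measure lebesgue (flip j -` A \<inter> {0..<1})"
    by (rule measure_restrict_space) auto
  also have "\<dots> = measure lebesgue (((+) (- 1 / 2 ^ Suc j)) ` Am \<union> ((+) (1 / 2 ^ Suc j)) ` Ap)"
    unfolding flip_vimage[OF A(1)] Am_def Ap_def ..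
  also have "\<dots> = measure lebesgue (((+) (- 1 / 2 ^ Suc j)) ` Am) + measure lebesgue (((+) (1 / 2 ^ Suc j)) ` Ap)"
    using S disj by (intro Un measurable_translation)
  also have "\<dots> = measure lebesgue Am + measure lebesgue Ap"
    by (simp only: measure_translation)
  also have "\<dots> = measure lebesgue (Am \<union> Ap)"
    using S by (intro Un[symmetric]) (auto simp: Am_def Ap_def)
  also have "Am \<union> Ap = A" using rademacher_cases[of j] by (auto simp: Am_def Ap_def)
  also have "measure lebesgue A = measure unit_measure A"
    using A by (simp add: measure_restrict_space)
  finally show ?thesis .
qed

lemma distr_flip: "distr unit_measure unit_measure (flip j) = unit_measure"
proof (rule measure_eqI)
  interpret finite_measure unit_measure by (rule prob_unit)
  interpret D: finite_measure "distr unit_measure unit_measure (flip j)"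
    by (rule finite_measure_distr[OF flip_measurable])
  fix A assume "A \<in> sets (distr unit_measure unit_measure (flip j))"
  then have A: "A \<in> sets unit_measure" by simp
  then have "measure (distr unit_measure unit_measure (flip j)) A = measure unit_measure A"
    by (simp add: measure_distr flip_measurable measure_flip_vimage)
  then show "emeasure (distr unit_measure unit_measure (flip j)) A = emeasure unit_measure A"
    by (simp add: emeasure_eq_measure D.emeasure_eq_measure)
qed simp

lemma walsh_abs: "\<bar>walsh n x\<bar> = 1"
  using wprod_sign[OF signs_rademacher[of x], of n] by (auto simp: walsh_eq_wprod)

lemma integrable_walsh: "integrable unit_measure (walsh n)"
  by (rule finite_measure.integrable_const_bound[OF prob_unit(2), of _ 1])
    (auto simp: walsh_abs borel_imp_unit_measurable)

lemma integral_one: "(\<integral>x. (c::real) \<partial>unit_measure) = c"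
  using prob_unit by (simp add: measure_def)

text \<open>
  If bit \<open>j\<close> of \<open>n\<close> is 1, then the measure preserving map \<open>flip j\<close> reverses the sign of
  \<open>w\<^sub>n\<close>.
\<close>

lemma integral_walsh: "(\<integral>x. walsh n x \<partial>unit_measure) = of_bool (n = 0)"
proof (cases "n = 0")
  case True
  then show ?thesis using integral_one[of 1] by (simp add: walsh_eq_wprod)
next
  case False
  then obtain j where j: "bit n j" by (metis bit_0_eq bit_eq_iff bot_apply bot_bool_def)
  have flip: "walsh n (flip j x) = - walsh n x" if "x \<in> {0..<1}" for x
  proof -
    have "walsh n (flip j x) = (\<Prod>k\<in>{k. bit n k}. (if k = j then - 1 else 1) * rademacher k x)"
      unfolding walsh_def using flip_digits(2)[OF that, of _ j] by (intro prod.cong) auto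
    also have "\<dots> = - walsh n x"
      using j finite_bits[of n] by (simp add: prod.distrib walsh_def prod.delta)
    finally show ?thesis .
  qed
  have "(\<integral>x. walsh n x \<partial>unit_measure) = (\<integral>x. walsh n x \<partial>distr unit_measure unit_measure (flip j))"
    by (simp only: distr_flip)
  also have "\<dots> = (\<integral>x. walsh n (flip j x) \<partial>unit_measure)"
    by (rule integral_distr[OF flip_measurable]) (simp add: borel_imp_unit_measurable)
  also have "\<dots> = (\<integral>x. - walsh n x \<partial>unit_measure)"
    by (rule Bochner_Integration.integral_cong) (auto simp: flip)
  finally show ?thesis using False by simp
qed

lemma walsh_times: "walsh m x * walsh n x = walsh (xor m n) x"
proof -
  let ?r = "\<lambda>k. rademacher k x"
  have sq: "?r k * ?r k = 1" for k using rademacher_cases[of k x] by auto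
  have split: "walsh p x = (\<Prod>k\<in>{k. bit m k} \<union> {k. bit n k}. if bit p k then ?r k else 1)"
    if "\<And>k. bit p k \<Longrightarrow> bit m k \<or> bit n k" for p
  proof -
    have "{k \<in> {k. bit m k} \<union> {k. bit n k}. bit p k} = {k. bit p k}" using that by auto
    then show ?thesis unfolding walsh_def
      using prod.inter_filter[of "{k. bit m k} \<union> {k. bit n k}" ?r "bit p"] by (simp add: finite_bits)
  qed
  have "walsh m x * walsh n x = (\<Prod>k\<in>{k. bit m k} \<union> {k. bit n k}.
      (if bit m k then ?r k else 1) * (if bit n k then ?r k else 1))"
    by (simp only: split[of m] split[of n] prod.distrib disjI1 disjI2)
  also have "\<dots> = (\<Prod>k\<in>{k. bit m k} \<union> {k. bit n k}. if bit (xor m n) k then ?r k else 1)"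
    by (intro prod.cong) (auto simp: bit_simps sq)
  also have "\<dots> = walsh (xor m n) x"
    by (rule split[symmetric]) (auto simp: bit_simps)
  finally show ?thesis .
qed

lemma integral_walsh_walsh: "(\<integral>x. walsh m x * walsh n x \<partial>unit_measure) = of_bool (m = n)"
proof -
  have "xor m n = 0 \<longleftrightarrow> m = n"
    by (auto simp: bit_eq_iff bit_simps)
  then show ?thesis by (simp add: walsh_times integral_walsh)
qed

section \<open>Averages over flipped cells: a weak-type inequality\<close>

definition cell_avg :: "(real \<Rightarrow> real) \<Rightarrow> nat \<Rightarrow> real \<Rightarrow> real" where
  "cell_avg g a x = 2 ^ a * (\<integral>t. indicator (cell a x) t * g t \<partial>unit_measure)"

text \<open>
  The integral of \<open>g\<close> against the majorant of the Fejer kernel of order \<open>2 ^ i\<close> found in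
  \<open>fejer_bound\<close>, up to the factor 2.  The summand \<open>j = i\<close> is the average over the cell of \<open>x\<close> itself.
\<close>

definition flip_avg :: "(real \<Rightarrow> real) \<Rightarrow> nat \<Rightarrow> real \<Rightarrow> real" where
  "flip_avg g i x = (\<Sum>j\<le>i. 2 ^ j / 2 ^ i * cell_avg g i (flip j x))"

lemma integrable_indicator_times:
  assumes "integrable unit_measure (g :: real \<Rightarrow> real)" and "A \<in> sets unit_measure"
  shows "integrable unit_measure (\<lambda>t. indicator A t * g t)"
  using integrable_mult_indicator[OF assms(2,1)] by simp

lemma integrable_cell:
  assumes "integrable unit_measure (g :: real \<Rightarrow> real)" and "x \<in> {0..<1}"
  shows "integrable unit_measure (\<lambda>t. indicator (cell a x) t * g t)"
  by (intro integrable_indicator_times cell_measurable assms)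

lemma integral_indicator_cell:
  "x \<in> {0..<1} \<Longrightarrow> (\<integral>t. indicator (cell a x) t \<partial>unit_measure) = (1 / 2 ^ a :: real)"
  using cell_measurable[of x a] measure_cell[of x a] cell_subset_unit[of a x]
  by (simp add: Int_absorb2)

lemma cell_avg_mono:
  assumes "integrable unit_measure g" and "integrable unit_measure h"
    and "x \<in> {0..<1}" and "\<And>t. t \<in> cell a x \<Longrightarrow> g t \<le> h t"
  shows "cell_avg g a x \<le> cell_avg h a x"
proof -
  have "indicator (cell a x) t * g t \<le> indicator (cell a x) t * h t" for t
    using assms(4)[of t] by (simp split: split_indicator)
  then show ?thesis
    unfolding cell_avg_def using integrable_cell[OF assms(1,3)] integrable_cell[OF assms(2,3)]
    by (intro mult_left_mono[OF integral_mono]) auto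
qed

lemma cell_avg_add:
  assumes "integrable unit_measure g" and "integrable unit_measure h" and "x \<in> {0..<1}"
  shows "cell_avg (\<lambda>t. g t + h t) a x = cell_avg g a x + cell_avg h a x"
  using integrable_cell[OF assms(1,3)] integrable_cell[OF assms(2,3)]
  by (simp add: cell_avg_def distrib_left)

lemma cell_avg_const: "x \<in> {0..<1} \<Longrightarrow> cell_avg (\<lambda>t. c) a x = c"
  using integral_indicator_cell[of x a] by (simp add: cell_avg_def del: Bochner_Integration.integral_indicator)

lemma cell_avg_nonneg: "(\<And>t. 0 \<le> g t) \<Longrightarrow> 0 \<le> cell_avg g a x"
  by (simp add: cell_avg_def)

lemma flip_avg_nonneg: "(\<And>t. 0 \<le> g t) \<Longrightarrow> 0 \<le> flip_avg g i x"
  unfolding flip_avg_def by (intro sum_nonneg mult_nonneg_nonneg cell_avg_nonneg) auto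

lemma flip_avg_mono:
  assumes "integrable unit_measure g" and "integrable unit_measure h"
    and "x \<in> {0..<1}" and "\<And>t. t \<in> {0..<1} \<Longrightarrow> g t \<le> h t"
  shows "flip_avg g i x \<le> flip_avg h i x"
  unfolding flip_avg_def
  by (intro sum_mono mult_left_mono cell_avg_mono flip_digits(1) assms subsetD[OF cell_subset_unit]) auto

lemma flip_avg_add:
  assumes "integrable unit_measure g" and "integrable unit_measure h" and "x \<in> {0..<1}"
  shows "flip_avg (\<lambda>t. g t + h t) i x = flip_avg g i x + flip_avg h i x"
  unfolding flip_avg_def
  by (simp add: cell_avg_add[OF assms(1,2) flip_digits(1)[OF assms(3)]] distrib_left sum.distrib)

lemma sum_pow2_ratio_le: "(\<Sum>j<n. 2 ^ j / 2 ^ i :: real) \<le> 2 ^ n / 2 ^ i"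
proof -
  have "(\<Sum>j<n. 2 ^ j / 2 ^ i :: real) = (2 ^ n - 1) / 2 ^ i"
    by (simp add: sum_divide_distrib[symmetric] geometric_sum)
  then show ?thesis by (simp add: divide_right_mono)
qed

lemma flip_avg_const_le:
  assumes "x \<in> {0..<1}" and "0 \<le> c"
  shows "flip_avg (\<lambda>t. c) i x \<le> 2 * c"
proof -
  have "flip_avg (\<lambda>t. c) i x = (\<Sum>j<Suc i. 2 ^ j / 2 ^ i) * c"
    by (simp only: flip_avg_def cell_avg_const[OF flip_digits(1)[OF assms(1)]] sum_distrib_right lessThan_Suc_atMost)
  also have "\<dots> \<le> (2 ^ Suc i / 2 ^ i) * c"
    by (intro mult_right_mono sum_pow2_ratio_le assms)
  finally show ?thesis by simp
qed

text \<open>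
  Measurability of \<open>cell_avg g a\<close> becomes clear from the right-hand side, a function of an integer
  that depends measurably on \<open>x\<close>.
\<close>

lemma cell_avg_floor:
  assumes "x \<in> {0..<1}"
  shows "cell_avg g a x =
    2 ^ a * (\<integral>t. indicator {t \<in> {0..<1}. \<lfloor>t * 2 ^ a\<rfloor> = \<lfloor>x * 2 ^ a\<rfloor>} t * g t \<partial>unit_measure)"
proof -
  have "cell a x = {t \<in> {0..<1}. \<lfloor>t * 2 ^ a\<rfloor> = \<lfloor>x * 2 ^ a\<rfloor>}"
    using mem_cell_iff_floor[OF assms] cell_subset_unit[of a x] by auto
  then show ?thesis by (simp add: cell_avg_def)
qed

lemma cell_avg_measurable: "cell_avg g a \<in> borel_measurable unit_measure"
proof -
  let ?F = "\<lambda>x. 2 ^ a * (\<integral>t. indicator {t \<in> {0..<1}. \<lfloor>t * 2 ^ a\<rfloor> = \<lfloor>x * 2 ^ a\<rfloor>} t * g t \<partial>unit_measure)"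
  have F: "?F \<in> borel_measurable unit_measure"
    by (intro borel_imp_unit_measurable measurable_floor_fun)
  have eq: "cell_avg g a x = ?F x" if "x \<in> space unit_measure" for x
    using that unfolding space_unit by (rule cell_avg_floor)
  show ?thesis
    using F measurable_cong[of unit_measure "cell_avg g a" ?F borel, OF eq] by blast
qed

lemma measure_le_of_cell_avg:
  assumes g: "integrable unit_measure g" and U: "U \<in> sets unit_measure"
    and cells: "\<And>x. x \<in> U \<Longrightarrow> cell m x \<subseteq> U" and avg: "\<And>x. x \<in> U \<Longrightarrow> \<gamma> \<le> cell_avg g m x"
  shows "\<gamma> * measure unit_measure U \<le> (\<integral>t. indicator U t * g t \<partial>unit_measure)"
proof -
  interpret finite_measure unit_measure by (rule prob_unit)
  have Usub: "U \<subseteq> {0..<1}" using U by (simp add: sets_restrict_space_iff)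
  define P where "P = (\<lambda>x. \<lfloor>x * 2 ^ m\<rfloor>) ` U"
  define C where "C p = {t \<in> {0..<1::real}. \<lfloor>t * 2 ^ m\<rfloor> = p}" for p
  \<comment> \<open>the cells of level m in the unit interval are numbered by these integers\<close>
  have "P \<subseteq> {0..<2 ^ m}" unfolding P_def using Usub floor_mult_pow2_range[of _ m] by auto
  then have finP: "finite P" by (rule finite_subset) simp
  have Ccell: "\<exists>x\<in>U. C p = cell m x" if p: "p \<in> P" for p
  proof -
    obtain x where x: "x \<in> U" "p = \<lfloor>x * 2 ^ m\<rfloor>" using p unfolding P_def by blast
    then have "x \<in> {0..<1}" using Usub by auto
    then have "C p = cell m x"
      using mem_cell_iff_floor[of x _ m] cell_subset_unit[of m x] x by (auto simp: C_def)
    then show ?thesis using x by blast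
  qed
  have Un: "U = (\<Union>p\<in>P. C p)"
  proof
    show "U \<subseteq> (\<Union>p\<in>P. C p)"
    proof
      fix x assume x: "x \<in> U"
      then have "x \<in> C \<lfloor>x * 2 ^ m\<rfloor>" using subsetD[OF Usub x] by (simp add: C_def)
      then show "x \<in> (\<Union>p\<in>P. C p)" using x by (force simp: P_def)
    qed
    show "(\<Union>p\<in>P. C p) \<subseteq> U" using Ccell cells by (metis UN_least)
  qed
  have ind: "indicator U t = (\<Sum>p\<in>P. indicator (C p) t :: real)" for t
    unfolding Un using finP by (intro indicator_UN_disjoint) (auto simp: disjoint_family_on_def C_def)
  have Cm: "C p \<in> sets unit_measure" if "p \<in> P" for p
    using Ccell[OF that] cell_measurable subsetD[OF Usub] by metis
  have each: "\<gamma> * measure unit_measure (C p) \<le> (\<integral>t. indicator (C p) t * g t \<partial>unit_measure)" if "p \<in> P" for p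
  proof -
    obtain x where x: "x \<in> U" "C p = cell m x" using Ccell \<open>p \<in> P\<close> by blast
    then have x1: "x \<in> {0..<1}" using Usub by blast
    have "\<gamma> \<le> cell_avg g m x" by (rule avg) (rule x)
    then show ?thesis
      unfolding x(2) measure_cell[OF x1] by (simp add: cell_avg_def field_simps)
  qed
  have "\<gamma> * measure unit_measure U = (\<Sum>p\<in>P. \<gamma> * measure unit_measure (C p))"
    unfolding Un sum_distrib_left[symmetric] using finP Cm
    by (subst finite_measure_finite_Union) (auto simp: disjoint_family_on_def C_def)
  also have "\<dots> \<le> (\<Sum>p\<in>P. \<integral>t. indicator (C p) t * g t \<partial>unit_measure)"
    by (rule sum_mono) (rule each)
  also have "\<dots> = (\<integral>t. (\<Sum>p\<in>P. indicator (C p) t * g t) \<partial>unit_measure)"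
    by (rule Bochner_Integration.integral_sum[symmetric]) (intro integrable_indicator_times g Cm)
  also have "\<dots> = (\<integral>t. indicator U t * g t \<partial>unit_measure)"
    by (simp add: ind sum_distrib_right)
  finally show ?thesis .
qed

text \<open>
  The level sets of the dyadic stopping time: the average of \<open>g\<close> exceeds \<open>\<gamma>\<close> at level \<open>m\<close> for the
  first time.  They are disjoint, and each is a union of cells of level \<open>m\<close>.
\<close>

definition first_exceed :: "(real \<Rightarrow> real) \<Rightarrow> real \<Rightarrow> nat \<Rightarrow> real set" where
  "first_exceed g \<gamma> m = {x \<in> {0..<1}. \<gamma> < cell_avg g m x \<and> (\<forall>i<m. cell_avg g i x \<le> \<gamma>)}"

lemma first_exceed_measurable: "first_exceed g \<gamma> m \<in> sets unit_measure"
proof -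
  note [measurable] = cell_avg_measurable
  have "{x \<in> space unit_measure. \<gamma> < cell_avg g m x \<and> (\<forall>i<m. cell_avg g i x \<le> \<gamma>)} \<in> sets unit_measure"
    by measurable
  then show ?thesis by (simp add: first_exceed_def)
qed

lemma first_exceed_cell:
  assumes "x \<in> first_exceed g \<gamma> m"
  shows "cell m x \<subseteq> first_exceed g \<gamma> m"
proof
  fix t assume t: "t \<in> cell m x"
  have "cell_avg g i t = cell_avg g i x" if "i \<le> m" for i
  proof -
    have "t \<in> cell i x" using cell_mono[OF that] t by blast
    then have "cell i t = cell i x" by (rule cell_cong)
    then show ?thesis by (simp add: cell_avg_def)
  qed
  then show "t \<in> first_exceed g \<gamma> m"
    using assms t cell_subset_unit[of m x] by (auto simp: first_exceed_def)
qed

lemma first_exceed_disjoint: "m \<noteq> n \<Longrightarrow> first_exceed g \<gamma> m \<inter> first_exceed g \<gamma> n = {}"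
proof -
  assume "m \<noteq> n"
  then consider "m < n" | "n < m" by linarith
  then show ?thesis by cases (force simp: first_exceed_def)+
qed

text \<open>
  The dyadic maximal inequality, stated for the disjoint pieces of the exceptional set because each
  piece will be transported by a different flip.
\<close>

lemma sum_measure_first_exceed:
  assumes g: "integrable unit_measure g" and nn: "\<And>t. 0 \<le> g t" and "0 < \<gamma>"
  shows "(\<Sum>m<n. measure unit_measure (first_exceed g \<gamma> m)) \<le> (\<integral>t. g t \<partial>unit_measure) / \<gamma>"
proof -
  let ?U = "first_exceed g \<gamma>"
  have "\<gamma> * (\<Sum>m<n. measure unit_measure (?U m)) \<le> (\<Sum>m<n. \<integral>t. indicator (?U m) t * g t \<partial>unit_measure)"
    unfolding sum_distrib_left
    by (intro sum_mono measure_le_of_cell_avg[OF g first_exceed_measurable first_exceed_cell])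
      (auto simp: first_exceed_def)
  also have "\<dots> = (\<integral>t. (\<Sum>m<n. indicator (?U m) t * g t) \<partial>unit_measure)"
    by (rule Bochner_Integration.integral_sum[symmetric]) (intro integrable_indicator_times g first_exceed_measurable)
  also have "\<dots> \<le> (\<integral>t. g t \<partial>unit_measure)"
  proof (rule integral_mono[OF _ g])
    show "integrable unit_measure (\<lambda>t. \<Sum>m<n. indicator (?U m) t * g t)"
      by (intro Bochner_Integration.integrable_sum integrable_indicator_times g first_exceed_measurable)
    fix t
    have "(\<Sum>m<n. indicator (?U m) t :: real) = indicator (\<Union>m<n. ?U m) t"
      by (rule indicator_UN_disjoint[symmetric]) (auto simp: disjoint_family_on_def first_exceed_disjoint)
    also have "\<dots> \<le> 1" by (rule indicator_le_1)
    finally have "(\<Sum>m<n. indicator (?U m) t) * g t \<le> 1 * g t"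
      by (rule mult_right_mono) (rule nn)
    then show "(\<Sum>m<n. indicator (?U m) t * g t) \<le> g t" by (simp only: sum_distrib_right mult_1)
  qed
  finally show ?thesis using \<open>0 < \<gamma>\<close> by (simp add: field_simps)
qed

text \<open>
  The index \<open>s\<close> is the distance between the flipped digit \<open>m\<close> and the stopping level \<open>m + s\<close>.  For
  \<open>s = 0\<close> the flip stays inside each stopping cell, so this case covers the stopping sets themselves.
\<close>

definition shifted_exceed :: "(real \<Rightarrow> real) \<Rightarrow> real \<Rightarrow> nat \<Rightarrow> real set" where
  "shifted_exceed g \<gamma> s = (\<Union>m. flip m -` first_exceed g \<gamma> (m + s) \<inter> {0..<1})"

lemma shifted_exceed_measure:
  assumes g: "integrable unit_measure g" and nn: "\<And>t. 0 \<le> g t" and "0 < \<gamma>"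
  shows "shifted_exceed g \<gamma> s \<in> sets unit_measure"
    and "measure unit_measure (shifted_exceed g \<gamma> s) \<le> (\<integral>t. g t \<partial>unit_measure) / \<gamma>"
proof -
  interpret finite_measure unit_measure by (rule prob_unit)
  let ?T = "\<lambda>m. flip m -` first_exceed g \<gamma> (m + s) \<inter> {0..<1}"
  have meas: "?T m \<in> sets unit_measure" for m
    using measurable_sets[OF flip_measurable first_exceed_measurable[of g \<gamma> "m + s"], of m]
    by (simp only: space_unit)
  then show "shifted_exceed g \<gamma> s \<in> sets unit_measure"
    unfolding shifted_exceed_def by (intro sets.countable_UN image_subsetI)
  have partial: "(\<Sum>m<n. measure unit_measure (?T m)) \<le> (\<integral>t. g t \<partial>unit_measure) / \<gamma>" for n
  proof -
    have "(\<Sum>m<n. measure unit_measure (?T m)) = (\<Sum>m<n. measure unit_measure (first_exceed g \<gamma> (m + s)))"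
      by (simp only: measure_flip_vimage[OF first_exceed_measurable])
    also have "\<dots> = (\<Sum>m\<in>{s..<n+s}. measure unit_measure (first_exceed g \<gamma> m))"
      by (rule sum.reindex_bij_witness[of _ "\<lambda>m. m - s" "\<lambda>m. m + s"]) auto
    also have "\<dots> \<le> (\<Sum>m<n+s. measure unit_measure (first_exceed g \<gamma> m))"
      by (rule sum_mono2) auto
    finally show ?thesis using sum_measure_first_exceed[OF g nn \<open>0 < \<gamma>\<close>, of "n+s"] by linarith
  qed
  have summ: "summable (\<lambda>m. measure unit_measure (?T m))"
    by (rule summableI_nonneg_bounded[OF _ partial]) simp
  have "measure unit_measure (shifted_exceed g \<gamma> s) \<le> (\<Sum>m. measure unit_measure (?T m))"
    unfolding shifted_exceed_def using meas summ by (intro finite_measure_subadditive_countably) auto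
  also have "\<dots> \<le> (\<integral>t. g t \<partial>unit_measure) / \<gamma>"
    using suminf_le_const[OF summ partial] .
  finally show "measure unit_measure (shifted_exceed g \<gamma> s) \<le> (\<integral>t. g t \<partial>unit_measure) / \<gamma>" .
qed

text \<open>
  Let \<open>y = flip (i - k) x\<close> and let \<open>m \<le> i\<close> be the first level at which the average around \<open>y\<close> exceeds
  \<open>\<gamma>\<close>.  If \<open>m \<le> i - k\<close>, then the flip does not leave the cell of level \<open>m\<close>, so \<open>x\<close> lies in the same
  stopping set.  Otherwise \<open>m\<close> exceeds \<open>i - k\<close> by some \<open>s\<close> with \<open>1 \<le> s \<le> k\<close>.  The point is that
  \<open>k + 1\<close> exceptional sets suffice for all \<open>i\<close> together.
\<close>

lemma flip_cell_avg_exceed: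
  assumes x: "x \<in> {0..<1}" and "k \<le> i" and "\<gamma> < cell_avg g i (flip (i - k) x)"
  shows "\<exists>s\<le>k. x \<in> shifted_exceed g \<gamma> s"
proof -
  let ?y = "flip (i - k) x"
  define m where "m = (LEAST m. \<gamma> < cell_avg g m ?y)"
  have m: "\<gamma> < cell_avg g m ?y" "m \<le> i" "\<And>l. l < m \<Longrightarrow> cell_avg g l ?y \<le> \<gamma>"
    unfolding m_def using assms(3) LeastI Least_le not_less_Least by (metis, metis, metis not_less)
  then have y: "?y \<in> first_exceed g \<gamma> m"
    using flip_digits(1)[OF x] by (simp add: first_exceed_def)
  show ?thesis
  proof (cases "m \<le> i - k")
    case True
    have "cell m (flip m x) = cell m ?y"
      using cell_flip[OF True x] cell_flip[OF order_refl x] by simp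
    then have "flip m x \<in> first_exceed g \<gamma> m"
      using first_exceed_cell[OF y] cell_self[OF flip_digits(1)[OF x]] by blast
    then have "x \<in> shifted_exceed g \<gamma> 0" using x by (auto simp: shifted_exceed_def)
    then show ?thesis by blast
  next
    case False
    then have "i - k + (m - (i - k)) = m" by simp
    then have "x \<in> shifted_exceed g \<gamma> (m - (i - k))"
      unfolding shifted_exceed_def using x y by (intro UN_I[of "i - k"]) auto
    moreover have "m - (i - k) \<le> k" using m(2) assms(2) by simp
    ultimately show ?thesis by blast
  qed
qed

text \<open>
  The summand with \<open>j = i - k\<close> carries the weight \<open>2 ^ (-k)\<close>.  Bounding its cell average by the
  average over a cell containing \<open>x\<close> would cost a factor \<open>2 ^ k\<close>, and the sum over \<open>k\<close> would
  diverge.  Instead, the summand is allowed the threshold \<open>\<gamma> k = \<alpha> (3/2) ^ k\<close>: the total is then at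
  most \<open>\<alpha> \<Sum>k. (3/4) ^ k = 4 \<alpha>\<close>, while by \<open>flip_cell_avg_exceed\<close> the exceptional sets have total
  measure at most \<open>(\<Sum>k. (k + 1) (2/3) ^ k) / \<alpha> = 9 / \<alpha>\<close> times the integral of \<open>g\<close>.
\<close>

lemma flip_avg_weak_type:
  assumes g: "integrable unit_measure g" and nn: "\<And>t. 0 \<le> g t" and \<alpha>: "0 < \<alpha>"
  obtains E where "E \<in> sets unit_measure"
    and "measure unit_measure E \<le> 9 * (\<integral>t. g t \<partial>unit_measure) / \<alpha>"
    and "\<And>x i. x \<in> {0..<1} - E \<Longrightarrow> flip_avg g i x \<le> 4 * \<alpha>"
proof -
  interpret finite_measure unit_measure by (rule prob_unit)
  define I where "I = (\<integral>t. g t \<partial>unit_measure)"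
  define \<gamma> where "\<gamma> k = \<alpha> * (3 / 2) ^ k" for k :: nat
  have \<gamma>: "0 < \<gamma> k" for k using \<alpha> by (simp add: \<gamma>_def)
  define E where "E k = (\<Union>s\<le>k. shifted_exceed g (\<gamma> k) s)" for k
  have Em: "E k \<in> sets unit_measure" for k
    unfolding E_def by (intro sets.finite_UN shifted_exceed_measure(1)[OF g nn \<gamma>]) auto
  have E: "measure unit_measure (E k) \<le> real (Suc k) * (2 / 3) ^ k * (I / \<alpha>)" for k
  proof -
    have "measure unit_measure (E k) \<le> (\<Sum>s\<le>k. measure unit_measure (shifted_exceed g (\<gamma> k) s))"
      unfolding E_def
      by (rule finite_measure_subadditive_finite) (auto intro: shifted_exceed_measure(1)[OF g nn \<gamma>])
    also have "\<dots> \<le> (\<Sum>s\<le>k. I / \<gamma> k)"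
      unfolding I_def by (rule sum_mono) (rule shifted_exceed_measure(2)[OF g nn \<gamma>])
    also have "\<dots> = real (Suc k) * (2 / 3) ^ k * (I / \<alpha>)"
      by (simp add: \<gamma>_def power_divide field_simps)
    finally show ?thesis .
  qed
  have sums: "(\<lambda>k. real (Suc k) * (2 / 3) ^ k * (I / \<alpha>)) sums (9 * (I / \<alpha>))"
    using sums_mult2[OF geometric_deriv_sums[of "2 / 3 :: real"], of "I / \<alpha>"] by (simp add: power2_eq_square)
  have summ: "summable (\<lambda>k. measure unit_measure (E k))"
    by (rule summable_comparison_test'[OF sums_summable[OF sums], of 0]) (use E in simp)
  show thesis
  proof
    show "(\<Union>k. E k) \<in> sets unit_measure" by (intro sets.countable_UN image_subsetI Em)
    have "measure unit_measure (\<Union>k. E k) \<le> (\<Sum>k. measure unit_measure (E k))"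
      using Em summ by (intro finite_measure_subadditive_countably) auto
    also have "\<dots> \<le> (\<Sum>k. real (Suc k) * (2 / 3) ^ k * (I / \<alpha>))"
      by (rule suminf_le[OF E summ sums_summable[OF sums]])
    also have "\<dots> = 9 * (I / \<alpha>)" using sums by (rule sums_unique[symmetric])
    finally show "measure unit_measure (\<Union>k. E k) \<le> 9 * (\<integral>t. g t \<partial>unit_measure) / \<alpha>"
      by (simp add: I_def)
    fix x i assume x: "x \<in> {0..<1} - (\<Union>k. E k)"
    have le: "cell_avg g i (flip (i - k) x) \<le> \<gamma> k" if "k \<le> i" for k
      using flip_cell_avg_exceed[of x k i "\<gamma> k" g] that x by (force simp: E_def not_less)
    have "flip_avg g i x = (\<Sum>k\<le>i. 2 ^ (i - k) / 2 ^ i * cell_avg g i (flip (i - k) x))"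
      unfolding flip_avg_def by (rule sum.reindex_bij_witness[of _ "\<lambda>k. i - k" "\<lambda>k. i - k"]) auto
    also have "\<dots> \<le> (\<Sum>k\<le>i. 2 ^ (i - k) / 2 ^ i * \<gamma> k)"
      using le by (intro sum_mono mult_left_mono) auto
    also have "\<dots> = (\<Sum>k\<le>i. \<alpha> * (3 / 4) ^ k)"
    proof (rule sum.cong[OF refl])
      fix k assume "k \<in> {..i}"
      then have "(2::real) ^ (i - k) / 2 ^ i = 1 / 2 ^ k" by (simp add: power_diff)
      then show "2 ^ (i - k) / 2 ^ i * \<gamma> k = \<alpha> * (3 / 4) ^ k"
        by (simp add: \<gamma>_def power_divide power_mult_distrib[symmetric])
    qed
    also have "\<dots> = \<alpha> * (\<Sum>k<Suc i. (3 / 4) ^ k)"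
      by (simp only: sum_distrib_left lessThan_Suc_atMost)
    also have "\<dots> = \<alpha> * (4 * (1 - (3 / 4) ^ Suc i))"
      by (subst geometric_sum) (auto simp: field_simps)
    also have "\<dots> \<le> \<alpha> * 4" using \<alpha> by (intro mult_left_mono) auto
    finally show "flip_avg g i x \<le> 4 * \<alpha>" by simp
  qed
qed

section \<open>Convergence of the averages over flipped cells almost everywhere\<close>

lemma unit_dominated:
  fixes s :: "nat \<Rightarrow> real \<Rightarrow> real"
  assumes "f \<in> borel_measurable unit_measure" and "\<And>n. s n \<in> borel_measurable unit_measure"
    and "integrable unit_measure w"
    and "AE x in unit_measure. (\<lambda>n. s n x) \<longlonglongrightarrow> f x"
    and "\<And>n x. \<bar>s n x\<bar> \<le> w x"
  shows "(\<lambda>n. \<integral>x. \<bar>f x - s n x\<bar> \<partial>unit_measure) \<longlonglongrightarrow> 0"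
proof -
  have wlim: "AE x in unit_measure. \<bar>f x\<bar> \<le> w x"
    using assms(4)
  proof eventually_elim
    case (elim x)
    then have "(\<lambda>n. \<bar>s n x\<bar>) \<longlonglongrightarrow> \<bar>f x\<bar>" by (rule tendsto_rabs)
    then show ?case by (rule LIMSEQ_le_const2) (use assms(5) in auto)
  qed
  have "(\<lambda>n. \<integral>x. \<bar>f x - s n x\<bar> \<partial>unit_measure) \<longlonglongrightarrow> (\<integral>x. 0 \<partial>unit_measure)"
  proof (rule integral_dominated_convergence[where w = "\<lambda>x. 2 * w x"])
    show "AE x in unit_measure. (\<lambda>n. \<bar>f x - s n x\<bar>) \<longlonglongrightarrow> 0"
      using assms(4)
    proof eventually_elim
      case (elim x)
      from tendsto_rabs[OF tendsto_diff[OF tendsto_const elim, of "f x"]] show ?case by simp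
    qed
    show "AE x in unit_measure. norm \<bar>f x - s n x\<bar> \<le> 2 * w x" for n
      using wlim
    proof eventually_elim
      case (elim x)
      then show ?case using assms(5)[of n x] by simp
    qed
    show "(\<lambda>x. \<bar>f x - s n x\<bar>) \<in> borel_measurable unit_measure" for n
      using assms(1,2) by measurable
    show "integrable unit_measure (\<lambda>x. 2 * w x)" using assms(3) by simp
  qed simp
  then show ?thesis by simp
qed

lemma integrable_unit_bounded:
  assumes "h \<in> borel_measurable unit_measure" and "\<And>x. \<bar>h x :: real\<bar> \<le> B"
  shows "integrable unit_measure h"
  by (rule finite_measure.integrable_const_bound[OF prob_unit(2), of _ B]) (use assms in auto)

text \<open>
  Truncation makes \<open>f\<close> bounded; a measurable function is almost everywhere a limit of continuous
  functions, which may be truncated at the same height.  Both steps converge in the mean by dominated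
  convergence.
\<close>

lemma continuous_dense_L1:
  fixes f :: "real \<Rightarrow> real"
  assumes f: "integrable unit_measure f" and \<epsilon>: "0 < \<epsilon>"
  obtains h B where "continuous_on UNIV h" and "\<And>x. \<bar>h x\<bar> \<le> B"
    and "(\<integral>x. \<bar>f x - h x\<bar> \<partial>unit_measure) < \<epsilon>"
proof -
  have fm: "f \<in> borel_measurable unit_measure" using f by simp
  define clamp :: "nat \<Rightarrow> real \<Rightarrow> real" where "clamp N y = max (- real N) (min (real N) y)" for N y
  have clampc: "continuous_on UNIV (clamp N)" for N
    unfolding clamp_def[abs_def] by (intro continuous_intros)
  then have clampm: "clamp N \<in> borel_measurable borel" for N
    by (rule borel_measurable_continuous_onI)
  have clampb: "\<bar>clamp N y\<bar> \<le> real N" "\<bar>clamp N y\<bar> \<le> \<bar>y\<bar>" for N y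
    by (auto simp: clamp_def)
  have "(\<lambda>N. \<integral>x. \<bar>f x - clamp N (f x)\<bar> \<partial>unit_measure) \<longlonglongrightarrow> 0"
  proof (rule unit_dominated[where w = "\<lambda>x. \<bar>f x\<bar>"])
    show "AE x in unit_measure. (\<lambda>N. clamp N (f x)) \<longlonglongrightarrow> f x"
    proof (rule AE_I2)
      fix x
      obtain N where N: "\<bar>f x\<bar> \<le> real N" using real_arch_simple by blast
      have "\<forall>\<^sub>F n in sequentially. clamp n (f x) = f x"
        using eventually_ge_at_top[of N] by eventually_elim (use N in \<open>auto simp: clamp_def\<close>)
      then show "(\<lambda>N. clamp N (f x)) \<longlonglongrightarrow> f x" by (rule tendsto_eventually)
    qed
    show "(\<lambda>x. clamp N (f x)) \<in> borel_measurable unit_measure" for N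
      using clampm fm by (rule measurable_compose_rev)
  qed (use f fm clampb in auto)
  then have "\<forall>\<^sub>F N in sequentially. (\<integral>x. \<bar>f x - clamp N (f x)\<bar> \<partial>unit_measure) < \<epsilon> / 2"
    using \<epsilon> by (intro order_tendstoD(2)) auto
  from eventually_happens'[OF sequentially_bot this] obtain N where N: "(\<integral>x. \<bar>f x - clamp N (f x)\<bar> \<partial>unit_measure) < \<epsilon> / 2"
    by blast
  have "(\<lambda>x. if x \<in> {0..<1} then f x else 0) \<in> borel_measurable lebesgue"
    using fm by (subst borel_measurable_if) auto
  then have "(\<lambda>x. if x \<in> {0..<1} then f x else 0) measurable_on UNIV"
    by (rule lebesgue_measurable_imp_measurable_on_real) simp
  then obtain Z g where Z: "negligible Z" and g: "\<And>n. continuous_on UNIV (g n)"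
    and lim: "\<And>x. x \<notin> Z \<Longrightarrow> (\<lambda>n. g n x) \<longlonglongrightarrow> (if x \<in> {0..<1} then f x else 0)"
    unfolding measurable_on_def by auto
  have gc: "continuous_on UNIV (\<lambda>x. clamp N (g n x))" for n
    using continuous_on_compose2[OF clampc g] by simp
  have gm: "(\<lambda>x. clamp N (g n x)) \<in> borel_measurable unit_measure" for n
    by (intro borel_imp_unit_measurable borel_measurable_continuous_onI gc)
  have cfm: "(\<lambda>x. clamp N (f x)) \<in> borel_measurable unit_measure"
    using clampm fm by (rule measurable_compose_rev)
  have "(\<lambda>n. \<integral>x. \<bar>clamp N (f x) - clamp N (g n x)\<bar> \<partial>unit_measure) \<longlonglongrightarrow> 0"
  proof (rule unit_dominated[where w = "\<lambda>x. real N"])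
    have "Z \<inter> {0..<1} \<in> null_sets unit_measure"
    proof -
      have "Z \<inter> {0..<1} \<in> null_sets lebesgue"
        using Z by (simp add: negligible_iff_null_sets null_set_Int2)
      then show ?thesis by (subst null_sets_restrict_space) auto
    qed
    then show "AE x in unit_measure. (\<lambda>n. clamp N (g n x)) \<longlonglongrightarrow> clamp N (f x)"
    proof (rule AE_I')
      show "{x \<in> space unit_measure. \<not> (\<lambda>n. clamp N (g n x)) \<longlonglongrightarrow> clamp N (f x)} \<subseteq> Z \<inter> {0..<1}"
      proof clarify
        fix x assume x: "x \<in> space unit_measure" and no: "\<not> (\<lambda>n. clamp N (g n x)) \<longlonglongrightarrow> clamp N (f x)"
        have "(\<lambda>n. clamp N (g n x)) \<longlonglongrightarrow> clamp N (f x)" if "x \<notin> Z"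
        proof (rule continuous_on_tendsto_compose[OF clampc])
          show "(\<lambda>n. g n x) \<longlonglongrightarrow> f x" using lim[OF that] x by simp
        qed auto
        then show "x \<in> Z \<inter> {0..<1}" using no x by auto
      qed
    qed
    show "integrable unit_measure (\<lambda>x. real N)"
      by (rule integrable_unit_bounded[of _ "real N"]) auto
  qed (use cfm gm clampb in auto)
  then have "\<forall>\<^sub>F n in sequentially. (\<integral>x. \<bar>clamp N (f x) - clamp N (g n x)\<bar> \<partial>unit_measure) < \<epsilon> / 2"
    using \<epsilon> by (intro order_tendstoD(2)) auto
  from eventually_happens'[OF sequentially_bot this] obtain n where n: "(\<integral>x. \<bar>clamp N (f x) - clamp N (g n x)\<bar> \<partial>unit_measure) < \<epsilon> / 2"
    by blast
  have i1: "integrable unit_measure (\<lambda>x. \<bar>f x - clamp N (f x)\<bar>)"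
    and i2: "integrable unit_measure (\<lambda>x. \<bar>clamp N (f x) - clamp N (g n x)\<bar>)"
    and i3: "integrable unit_measure (\<lambda>x. \<bar>f x - clamp N (g n x)\<bar>)"
    by (intro integrable_abs Bochner_Integration.integrable_diff f integrable_unit_bounded[OF cfm clampb(1)]
        integrable_unit_bounded[OF gm clampb(1)])+
  have "(\<integral>x. \<bar>f x - clamp N (g n x)\<bar> \<partial>unit_measure)
      \<le> (\<integral>x. \<bar>f x - clamp N (f x)\<bar> + \<bar>clamp N (f x) - clamp N (g n x)\<bar> \<partial>unit_measure)"
    by (intro integral_mono i3 Bochner_Integration.integrable_add i1 i2) auto
  also have "\<dots> < \<epsilon>" using N n by (simp add: i1 i2)
  finally show thesis using that[OF gc clampb(1)] by blast
qed

lemma cell_dist: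
  assumes "x \<in> {0..<1}" and "t \<in> cell J x"
  shows "\<bar>t - x\<bar> \<le> 1 / 2 ^ J"
proof -
  have "t \<in> cell J x" "x \<in> cell J x" using assms cell_self by auto
  then have "of_int \<lfloor>x * 2 ^ J\<rfloor> / 2 ^ J \<le> t" "t < of_int \<lfloor>x * 2 ^ J\<rfloor> / 2 ^ J + 1 / 2 ^ J"
    "of_int \<lfloor>x * 2 ^ J\<rfloor> / 2 ^ J \<le> x" "x < of_int \<lfloor>x * 2 ^ J\<rfloor> / 2 ^ J + 1 / 2 ^ J"
    unfolding cell_eq_interval[OF assms(1)] by (simp_all add: add_divide_distrib)
  then show ?thesis by linarith
qed

text \<open>
  Changing a digit \<open>j \<ge> J\<close> moves \<open>x\<close> by at most \<open>2 ^ (-J)\<close>, so continuity controls the corresponding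
  cells.  The finitely many digits \<open>j < J\<close> have total weight at most \<open>2 ^ J / 2 ^ i\<close>, which tends to 0.
\<close>

lemma flip_avg_continuous:
  assumes h: "continuous_on UNIV h" and B: "\<And>x. \<bar>h x\<bar> \<le> B" and x: "x \<in> {0..<1}"
  shows "(\<lambda>i. flip_avg (\<lambda>t. \<bar>h t - h x\<bar>) i x) \<longlonglongrightarrow> 0"
proof (rule tendstoI)
  fix \<epsilon> :: real assume \<epsilon>: "0 < \<epsilon>"
  let ?g = "\<lambda>t. \<bar>h t - h x\<bar>"
  have hm: "h \<in> borel_measurable unit_measure"
    by (intro borel_imp_unit_measurable borel_measurable_continuous_onI h)
  have ci: "integrable unit_measure (\<lambda>t. c :: real)" for c
    by (rule integrable_unit_bounded[of _ "\<bar>c\<bar>"]) auto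
  have gb: "?g t \<le> 2 * B" for t using B[of t] B[of x] by linarith
  have gi: "integrable unit_measure ?g"
  proof (rule integrable_unit_bounded)
    show "?g \<in> borel_measurable unit_measure" using hm by measurable
    show "\<bar>?g t\<bar> \<le> 2 * B" for t using gb[of t] by simp
  qed
  obtain \<delta> where \<delta>: "0 < \<delta>" "\<And>t. \<bar>t - x\<bar> < \<delta> \<Longrightarrow> ?g t < \<epsilon> / 4"
    using h \<epsilon> unfolding continuous_on_iff dist_real_def by (metis UNIV_I zero_less_divide_iff zero_less_numeral)
  obtain J where J: "(1 / 2 :: real) ^ J < \<delta>"
    using real_arch_pow_inv[OF \<delta>(1), of "1 / 2"] by auto
  have small: "cell_avg ?g i (flip j x) \<le> \<epsilon> / 4" if "J \<le> j" "j \<le> i" for i j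
  proof -
    have "?g t \<le> \<epsilon> / 4" if "t \<in> cell i (flip j x)" for t
    proof -
      have "t \<in> cell J x"
        using that \<open>J \<le> j\<close> \<open>j \<le> i\<close> cell_flip[OF \<open>J \<le> j\<close> x] cell_mono[of J i "flip j x"] by auto
      then show ?thesis using cell_dist[OF x] J \<delta>(2)[of t] by (fastforce simp: power_divide)
    qed
    then have "cell_avg ?g i (flip j x) \<le> cell_avg (\<lambda>t. \<epsilon> / 4) i (flip j x)"
      by (intro cell_avg_mono gi ci flip_digits(1) x)
    then show ?thesis by (simp only: cell_avg_const[OF flip_digits(1)[OF x]])
  qed
  have big: "cell_avg ?g i (flip j x) \<le> 2 * B" for i j
  proof -
    have "cell_avg ?g i (flip j x) \<le> cell_avg (\<lambda>t. 2 * B) i (flip j x)"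
      by (intro cell_avg_mono gi ci flip_digits(1) x gb)
    then show ?thesis by (simp only: cell_avg_const[OF flip_digits(1)[OF x]])
  qed
  have B0: "0 \<le> B" using B[of x] by linarith
  have bound: "flip_avg ?g i x \<le> 2 ^ J * (2 * B) / 2 ^ i + \<epsilon> / 2" if "J \<le> i" for i
  proof -
    have "flip_avg ?g i x \<le> (\<Sum>j\<le>i. 2 ^ j / 2 ^ i * (of_bool (j < J) * (2 * B) + \<epsilon> / 4))"
      unfolding flip_avg_def
    proof (intro sum_mono mult_left_mono)
      fix j assume "j \<in> {..i}"
      then show "cell_avg ?g i (flip j x) \<le> of_bool (j < J) * (2 * B) + \<epsilon> / 4"
        using small[of j i] big[of i j] \<epsilon> by (cases "j < J") auto
    qed simp
    also have "\<dots> = (\<Sum>j\<le>i. if j < J then 2 ^ j / 2 ^ i * (2 * B) else 0) + (\<Sum>j<Suc i. 2 ^ j / 2 ^ i) * (\<epsilon> / 4)"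
      unfolding lessThan_Suc_atMost sum_distrib_right sum.distrib[symmetric]
      by (intro sum.cong) (auto simp: algebra_simps)
    also have "(\<Sum>j\<le>i. if j < J then 2 ^ j / 2 ^ i * (2 * B) else 0) = (\<Sum>j<J. 2 ^ j / 2 ^ i) * (2 * B)"
      unfolding sum_distrib_right using that
      by (intro sum.mono_neutral_cong_right) auto
    also have "\<dots> \<le> 2 ^ J / 2 ^ i * (2 * B)"
      using B0 by (intro mult_right_mono sum_pow2_ratio_le) auto
    also have "(\<Sum>j<Suc i. 2 ^ j / 2 ^ i :: real) * (\<epsilon> / 4) \<le> (2 ^ Suc i / 2 ^ i) * (\<epsilon> / 4)"
      using \<epsilon> by (intro mult_right_mono sum_pow2_ratio_le) auto
    finally show ?thesis by (simp add: algebra_simps)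
  qed
  have "(\<lambda>i. 2 ^ J * (2 * B) * (1 / 2) ^ i) \<longlonglongrightarrow> 2 ^ J * (2 * B) * 0"
    by (intro tendsto_mult tendsto_const LIMSEQ_power_zero) simp
  then have "\<forall>\<^sub>F i in sequentially. 2 ^ J * (2 * B) * (1 / 2) ^ i < \<epsilon> / 2"
    using \<epsilon> by (intro order_tendstoD(2)) auto
  then show "\<forall>\<^sub>F i in sequentially. dist (flip_avg ?g i x) 0 < \<epsilon>"
    using eventually_ge_at_top[of J]
  proof eventually_elim
    case (elim i)
    have "0 \<le> flip_avg ?g i x" by (rule flip_avg_nonneg) simp
    then show ?case using bound[OF elim(2)] elim(1) by (simp add: power_divide)
  qed
qed

text \<open>
  Approximate \<open>f\<close> by continuous functions \<open>h\<^sub>n\<close> up to \<open>4 ^ (-n)\<close> in the mean.  The weak-type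
  inequality with threshold \<open>2 ^ (-n)\<close> bounds the contribution of \<open>f - h\<^sub>n\<close> outside a set of measure
  \<open>O(2 ^ (-n))\<close>, and by the Borel--Cantelli lemma almost every point lies in only finitely many of
  these sets.
\<close>

theorem AE_flip_avg_tendsto_0:
  assumes f: "integrable unit_measure f"
  shows "AE x in unit_measure. (\<lambda>i. flip_avg (\<lambda>t. \<bar>f t - f x\<bar>) i x) \<longlonglongrightarrow> 0"
proof -
  interpret finite_measure unit_measure by (rule prob_unit)
  have "\<exists>h B. continuous_on UNIV h \<and> (\<forall>x. \<bar>h x\<bar> \<le> B) \<and> (\<integral>x. \<bar>f x - h x\<bar> \<partial>unit_measure) < (1 / 4) ^ n" for n :: nat
    using continuous_dense_L1[OF f, of "(1 / 4) ^ n"] by (metis zero_less_power zero_less_divide_1_iff zero_less_numeral)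
  then obtain h B where hc: "\<And>n::nat. continuous_on UNIV (h n)" and hB: "\<And>n x. \<bar>h n x\<bar> \<le> B n"
    and hf: "\<And>n. (\<integral>x. \<bar>f x - h n x\<bar> \<partial>unit_measure) < (1 / 4) ^ n"
    by metis
  define g where "g n x = \<bar>f x - h n x\<bar>" for n x
  have hm: "h n \<in> borel_measurable unit_measure" for n
    by (intro borel_imp_unit_measurable borel_measurable_continuous_onI hc)
  have hi: "integrable unit_measure (h n)" for n
    by (rule integrable_unit_bounded[OF hm hB])
  have gi: "integrable unit_measure (g n)" for n
    unfolding g_def[abs_def] by (intro integrable_abs Bochner_Integration.integrable_diff f hi)
  have g0: "0 \<le> g n x" for n x by (simp add: g_def)
  have gI: "(\<integral>t. g n t \<partial>unit_measure) \<le> (1 / 4) ^ n" for n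
    using hf[of n] by (simp add: g_def)
  have "\<exists>E. E \<in> sets unit_measure \<and> measure unit_measure E \<le> 10 * (1 / 2) ^ n \<and>
      (\<forall>x\<in>{0..<1} - E. g n x \<le> (1 / 2) ^ n \<and> (\<forall>i. flip_avg (g n) i x \<le> 4 * (1 / 2) ^ n))" for n
  proof -
    have p: "0 < (1 / 2 :: real) ^ n" by simp
    obtain E where E: "E \<in> sets unit_measure"
        "measure unit_measure E \<le> 9 * (\<integral>t. g n t \<partial>unit_measure) / (1 / 2) ^ n"
        "\<And>x i. x \<in> {0..<1} - E \<Longrightarrow> flip_avg (g n) i x \<le> 4 * (1 / 2) ^ n"
      using flip_avg_weak_type[OF gi g0 p] by metis
    \<comment> \<open>the value of g n at the point itself has to be small as well\<close>
    define F where "F = {x \<in> space unit_measure. (1 / 2) ^ n \<le> g n x}"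
    have Fm: "F \<in> sets unit_measure"
      unfolding F_def using borel_measurable_integrable[OF gi[of n]] by measurable
    have "measure unit_measure F \<le> (\<integral>t. g n t \<partial>unit_measure) / (1 / 2) ^ n"
      unfolding F_def by (rule integral_Markov_inequality_measure[OF gi sets.empty_sets]) (use g0 p in auto)
    then have "measure unit_measure (E \<union> F) \<le> 10 * (\<integral>t. g n t \<partial>unit_measure) / (1 / 2) ^ n"
      using E(2) measure_Un_le[OF E(1) Fm] by (simp add: field_simps)
    also have "\<dots> \<le> 10 * (1 / 4) ^ n / (1 / 2) ^ n"
      using gI[of n] by (intro divide_right_mono mult_left_mono) auto
    also have "\<dots> = 10 * (1 / 4 / (1 / 2)) ^ n" by (simp only: power_divide times_divide_eq_right)
    also have "\<dots> = 10 * (1 / 2) ^ n" by simp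
    finally have "measure unit_measure (E \<union> F) \<le> 10 * (1 / 2) ^ n" .
    moreover have "\<forall>x\<in>{0..<1} - (E \<union> F). g n x \<le> (1 / 2) ^ n \<and> (\<forall>i. flip_avg (g n) i x \<le> 4 * (1 / 2) ^ n)"
      using E(3) by (auto simp: F_def)
    ultimately show ?thesis using E(1) Fm by blast
  qed
  then obtain E where Em: "\<And>n. E n \<in> sets unit_measure" and Ele: "\<And>n. measure unit_measure (E n) \<le> 10 * (1 / 2) ^ n"
    and Ex: "\<And>n x. x \<in> {0..<1} - E n \<Longrightarrow> g n x \<le> (1 / 2) ^ n \<and> (\<forall>i. flip_avg (g n) i x \<le> 4 * (1 / 2) ^ n)"
    by metis
  have "summable (\<lambda>n. 10 * (1 / 2 :: real) ^ n)" by (intro summable_mult summable_geometric) simp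
  then have "summable (\<lambda>n. measure unit_measure (E n))"
    by (rule summable_comparison_test'[of _ 0]) (use Ele in simp)
  then have "AE x in unit_measure. \<forall>\<^sub>F n in sequentially. x \<in> space unit_measure - E n"
    by (intro borel_cantelli_AE1 Em) (auto simp: less_top[symmetric])
  then show ?thesis
  proof (rule AE_mp, intro AE_I2 impI)
    fix x assume "x \<in> space unit_measure" and ev: "\<forall>\<^sub>F n in sequentially. x \<in> space unit_measure - E n"
    then have x: "x \<in> {0..<1}" by simp
    let ?D = "\<lambda>i. flip_avg (\<lambda>t. \<bar>f t - f x\<bar>) i x"
    have ci: "integrable unit_measure (\<lambda>t. c :: real)" for c
      by (rule integrable_unit_bounded[of _ "\<bar>c\<bar>"]) auto
    have fi: "integrable unit_measure (\<lambda>t. \<bar>f t - f x\<bar>)"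
      by (intro integrable_abs Bochner_Integration.integrable_diff f ci)
    have hxi: "integrable unit_measure (\<lambda>t. \<bar>h n t - h n x\<bar>)" for n
      by (intro integrable_abs Bochner_Integration.integrable_diff hi ci)
    have split: "?D i \<le> flip_avg (g n) i x + flip_avg (\<lambda>t. \<bar>h n t - h n x\<bar>) i x + 2 * g n x" for i n
    proof -
      have "?D i \<le> flip_avg (\<lambda>t. (g n t + \<bar>h n t - h n x\<bar>) + g n x) i x"
        by (intro flip_avg_mono fi Bochner_Integration.integrable_add gi hxi ci x) (auto simp: g_def)
      also have "\<dots> = flip_avg (g n) i x + flip_avg (\<lambda>t. \<bar>h n t - h n x\<bar>) i x + flip_avg (\<lambda>t. g n x) i x"
        by (simp only: flip_avg_add[OF Bochner_Integration.integrable_add[OF gi hxi] ci x] flip_avg_add[OF gi hxi x])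
      also have "flip_avg (\<lambda>t. g n x) i x \<le> 2 * g n x" by (rule flip_avg_const_le[OF x g0])
      finally show ?thesis by simp
    qed
    show "?D \<longlonglongrightarrow> 0"
    proof (rule tendstoI)
      fix \<epsilon> :: real assume \<epsilon>: "0 < \<epsilon>"
      have "(\<lambda>n. (1 / 2 :: real) ^ n) \<longlonglongrightarrow> 0" by (rule LIMSEQ_power_zero) simp
      then have "\<forall>\<^sub>F n in sequentially. (1 / 2 :: real) ^ n < \<epsilon> / 12"
        using \<epsilon> by (intro order_tendstoD(2)) auto
      with ev have "\<forall>\<^sub>F n in sequentially. x \<in> space unit_measure - E n \<and> (1 / 2 :: real) ^ n < \<epsilon> / 12"
        by (rule eventually_conj)
      from eventually_happens'[OF sequentially_bot this]
      obtain n where n: "x \<in> {0..<1} - E n" "(1 / 2 :: real) ^ n < \<epsilon> / 12"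
        unfolding space_unit by blast
      have gn: "g n x \<le> (1 / 2) ^ n" "flip_avg (g n) i x \<le> 4 * (1 / 2) ^ n" for i
        using Ex[OF n(1)] by blast+
      have "\<forall>\<^sub>F i in sequentially. flip_avg (\<lambda>t. \<bar>h n t - h n x\<bar>) i x < \<epsilon> / 2"
        using flip_avg_continuous[OF hc hB x, of n] \<epsilon> by (intro order_tendstoD(2)) auto
      then show "\<forall>\<^sub>F i in sequentially. dist (?D i) 0 < \<epsilon>"
      proof eventually_elim
        case (elim i)
        have "0 \<le> ?D i" by (rule flip_avg_nonneg) simp
        moreover have "?D i < \<epsilon>"
          using split[of i n] elim gn(1) gn(2)[of i] n(2) by linarith
        ultimately show ?case by simp
      qed
    qed
  qed
qed

section \<open>De la Vallee Poussin means with a large averaging window\<close>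

abbreviation sign_product :: "real \<Rightarrow> real \<Rightarrow> nat \<Rightarrow> real" where
  "sign_product x t \<equiv> (\<lambda>k. rademacher k x * rademacher k t)"

lemma signs_sign_product: "signs (sign_product x t)"
  by (intro signs_mult signs_rademacher)

lemma wprod_sign_product: "wprod (sign_product x t) n = walsh n x * walsh n t"
  by (simp add: wprod_mult walsh_eq_wprod)

lemma integrable_mult_walsh:
  assumes "integrable unit_measure f"
  shows "integrable unit_measure (\<lambda>t. f t * walsh k t)"
proof (rule Bochner_Integration.integrable_bound[OF assms])
  show "(\<lambda>t. f t * walsh k t) \<in> borel_measurable unit_measure"
    by (intro borel_measurable_times borel_measurable_integrable[OF assms]
        borel_imp_unit_measurable walsh_measurable_borel)
qed (simp add: abs_mult walsh_abs)

lemma partial_sum_dirichlet: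
  assumes "integrable unit_measure f"
  shows "integrable unit_measure (\<lambda>t. f t * dirichlet (sign_product x t) n)"
    and "walsh_partial_sum n f x = (\<integral>t. f t * dirichlet (sign_product x t) n \<partial>unit_measure)"
proof -
  have eq: "f t * dirichlet (sign_product x t) n = (\<Sum>k<n. walsh k x * (f t * walsh k t))" for t
    by (simp add: dirichlet_def wprod_sign_product sum_distrib_left mult_ac)
  have i: "integrable unit_measure (\<lambda>t. walsh k x * (f t * walsh k t))" for k
    by (intro integrable_mult_right integrable_mult_walsh assms)
  show "integrable unit_measure (\<lambda>t. f t * dirichlet (sign_product x t) n)"
    unfolding eq by (intro Bochner_Integration.integrable_sum i)
  show "walsh_partial_sum n f x = (\<integral>t. f t * dirichlet (sign_product x t) n \<partial>unit_measure)"
    unfolding eq Bochner_Integration.integral_sum[OF i]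
    by (simp add: walsh_partial_sum_def walsh_coeff_def mult.commute)
qed

lemma sum_partial_sum_fejer:
  assumes "integrable unit_measure f"
  shows "integrable unit_measure (\<lambda>t. f t * fejer (sign_product x t) n)"
    and "(\<Sum>k<n. walsh_partial_sum k f x) = (\<integral>t. f t * fejer (sign_product x t) n \<partial>unit_measure)"
proof -
  have eq: "f t * fejer (sign_product x t) n = (\<Sum>k<n. f t * dirichlet (sign_product x t) k)" for t
    by (simp add: fejer_def sum_distrib_left)
  show "integrable unit_measure (\<lambda>t. f t * fejer (sign_product x t) n)"
    unfolding eq by (intro Bochner_Integration.integrable_sum partial_sum_dirichlet assms)
  show "(\<Sum>k<n. walsh_partial_sum k f x) = (\<integral>t. f t * fejer (sign_product x t) n \<partial>unit_measure)"
    unfolding eq by (simp add: partial_sum_dirichlet[OF assms])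
qed

lemma partial_sum_const: "walsh_partial_sum n (\<lambda>t. c) x = of_bool (0 < n) * c"
proof -
  have "walsh_coeff (\<lambda>t. c) k = of_bool (k = 0) * c" for k
    by (simp add: walsh_coeff_def integral_walsh)
  then have "walsh_partial_sum n (\<lambda>t. c) x = (\<Sum>k<n. if k = 0 then c else 0)"
    unfolding walsh_partial_sum_def by (intro sum.cong) (auto simp: walsh_eq_wprod)
  also have "\<dots> = of_bool (0 < n) * c" by (simp add: sum.delta')
  finally show ?thesis .
qed

text \<open>
  The kernel of \<open>\<Sum>k<n. S\<^sub>k\<close> has integral \<open>n - 1\<close> for \<open>n > 0\<close>, since \<open>S\<^sub>0 = 0\<close>; this accounts for the
  additional \<open>\<bar>f x\<bar>\<close>.  The bound depends on \<open>n\<close> only through \<open>A\<close>, so it can serve for both ends of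
  the averaging window.
\<close>

lemma sum_partial_sum_deviation:
  assumes f: "integrable unit_measure f" and x: "x \<in> {0..<1}" and n: "n < 2 ^ A"
  shows "\<bar>(\<Sum>k<n. walsh_partial_sum k f x) - real n * f x\<bar>
    \<le> \<bar>f x\<bar> + (\<Sum>a<A. 2 * 2 ^ a * flip_avg (\<lambda>t. \<bar>f t - f x\<bar>) a x)"
proof -
  let ?g = "\<lambda>t. \<bar>f t - f x\<bar>"
  let ?K = "\<lambda>t. fejer (sign_product x t) n"
  have ci: "integrable unit_measure (\<lambda>t. f x)"
    by (rule integrable_unit_bounded[of _ "\<bar>f x\<bar>"]) auto
  have gi: "integrable unit_measure ?g"
    by (intro integrable_abs Bochner_Integration.integrable_diff f ci)
  have di: "integrable unit_measure (\<lambda>t. f t - f x)"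
    by (intro Bochner_Integration.integrable_diff f ci)
  have "(\<Sum>k<n. walsh_partial_sum k (\<lambda>t. f x) x) = (\<Sum>k<n. f x) - of_bool (0 < n) * f x"
    unfolding partial_sum_const by (induction n) (auto simp: algebra_simps)
  then have const: "(\<integral>t. f x * ?K t \<partial>unit_measure) = real n * f x - of_bool (0 < n) * f x"
    unfolding sum_partial_sum_fejer(2)[OF ci] by simp
  have "(\<Sum>k<n. walsh_partial_sum k f x) - real n * f x
      = (\<integral>t. f t * ?K t \<partial>unit_measure) - (\<integral>t. f x * ?K t \<partial>unit_measure) - of_bool (0 < n) * f x"
    unfolding sum_partial_sum_fejer(2)[OF f] const by simp
  also have "\<dots> = (\<integral>t. (f t - f x) * ?K t \<partial>unit_measure) - of_bool (0 < n) * f x"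
    using sum_partial_sum_fejer(1)[OF f, of x n] sum_partial_sum_fejer(1)[OF ci, of x n]
    by (simp add: left_diff_distrib)
  finally have eq: "(\<Sum>k<n. walsh_partial_sum k f x) - real n * f x
      = (\<integral>t. (f t - f x) * ?K t \<partial>unit_measure) - of_bool (0 < n) * f x" .
  let ?S = "\<lambda>t. \<Sum>a<A. \<Sum>j\<le>a. 2 * 2 ^ (a + j) * (indicator (cell a (flip j x)) t * ?g t)"
  have Si: "integrable unit_measure ?S"
    by (intro Bochner_Integration.integrable_sum integrable_mult_right integrable_cell gi flip_digits(1) x)
  have bound: "\<bar>(f t - f x) * ?K t\<bar> \<le> ?S t" if t: "t \<in> {0..<1}" for t
  proof -
    have ind: "of_bool (single_flip (sign_product x t) a j) = (indicator (cell a (flip j x)) t :: real)" for a j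
      using mem_cell_flip_iff[OF x t, of a j] by (simp add: indicator_def)
    have "\<bar>(f t - f x) * ?K t\<bar> \<le> ?g t * (\<Sum>a<A. \<Sum>j\<le>a. 2 * 2 ^ (a + j) * indicator (cell a (flip j x)) t)"
      unfolding abs_mult ind[symmetric]
      by (intro mult_left_mono fejer_bound signs_sign_product n) simp
    also have "\<dots> = ?S t" by (simp add: sum_distrib_left mult_ac)
    finally show ?thesis .
  qed
  have "\<bar>\<integral>t. (f t - f x) * ?K t \<partial>unit_measure\<bar> \<le> (\<integral>t. \<bar>(f t - f x) * ?K t\<bar> \<partial>unit_measure)"
    by (rule integral_abs_bound)
  also have "\<dots> \<le> (\<integral>t. ?S t \<partial>unit_measure)"
    using bound by (intro integral_mono integrable_abs sum_partial_sum_fejer(1) di Si) auto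
  also have "\<dots> = (\<Sum>a<A. \<integral>t. (\<Sum>j\<le>a. 2 * 2 ^ (a + j) * (indicator (cell a (flip j x)) t * ?g t)) \<partial>unit_measure)"
    by (intro Bochner_Integration.integral_sum Bochner_Integration.integrable_sum integrable_mult_right integrable_cell gi flip_digits(1) x)
  also have "\<dots> = (\<Sum>a<A. 2 * 2 ^ a * flip_avg ?g a x)"
  proof (rule sum.cong[OF refl])
    fix a
    have "(\<integral>t. (\<Sum>j\<le>a. 2 * 2 ^ (a + j) * (indicator (cell a (flip j x)) t * ?g t)) \<partial>unit_measure)
      = (\<Sum>j\<le>a. 2 * 2 ^ (a + j) * (\<integral>t. indicator (cell a (flip j x)) t * ?g t \<partial>unit_measure))"
      by (subst Bochner_Integration.integral_sum)
        (simp_all add: integrable_cell[OF gi flip_digits(1)[OF x]] del: of_bool_eq)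
    also have "\<dots> = 2 * 2 ^ a * flip_avg ?g a x"
      by (simp add: flip_avg_def cell_avg_def sum_distrib_left power_add mult_ac)
    finally show "(\<integral>t. (\<Sum>j\<le>a. 2 * 2 ^ (a + j) * (indicator (cell a (flip j x)) t * ?g t)) \<partial>unit_measure)
      = 2 * 2 ^ a * flip_avg ?g a x" .
  qed
  finally show ?thesis unfolding eq by (cases "0 < n") auto
qed

text \<open>
  The total weight of the indices below \<open>A\<close> is of order \<open>2 ^ A\<close>, and it sits on the last few of them.
\<close>

lemma pow2_weighted_sum_small:
  fixes W :: "nat \<Rightarrow> real"
  assumes "W \<longlonglongrightarrow> 0" and nn: "\<And>a. 0 \<le> W a" and "0 < \<epsilon>"
  obtains K where "0 \<le> K" and "\<And>A. (\<Sum>a<A. 2 * 2 ^ a * W a) \<le> K + \<epsilon> * 2 ^ A"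
proof -
  obtain a0 where a0: "\<And>a. a0 \<le> a \<Longrightarrow> W a < \<epsilon> / 2"
    using order_tendstoD(2)[OF assms(1), of "\<epsilon> / 2"] \<open>0 < \<epsilon>\<close> by (auto simp: eventually_sequentially)
  define K where "K = (\<Sum>a<a0. 2 * 2 ^ a * W a)"
  have K0: "0 \<le> K" unfolding K_def using nn by (intro sum_nonneg) auto
  have "(\<Sum>a<A. 2 * 2 ^ a * W a) \<le> K + \<epsilon> * (2 ^ A - 1)" for A
  proof (induction A)
    case (Suc A)
    show ?case
    proof (cases "Suc A \<le> a0")
      case True
      have "(\<Sum>a<Suc A. 2 * 2 ^ a * W a) \<le> K"
        unfolding K_def using nn True by (intro sum_mono2) auto
      moreover have "0 \<le> \<epsilon> * (2 ^ Suc A - 1)"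
        using \<open>0 < \<epsilon>\<close> one_le_power[of "2 :: real" "Suc A"] by (intro mult_nonneg_nonneg) auto
      ultimately show ?thesis by linarith
    next
      case False
      then have "2 * 2 ^ A * W A \<le> 2 * 2 ^ A * (\<epsilon> / 2)"
        using a0[of A] by (intro mult_left_mono) auto
      moreover have "\<epsilon> * (2 ^ Suc A - 1) = \<epsilon> * (2 ^ A - 1) + 2 * 2 ^ A * (\<epsilon> / 2)"
        by (simp add: algebra_simps)
      ultimately show ?thesis using Suc.IH unfolding sum.lessThan_Suc by linarith
    qed
  qed (use K0 in simp)
  moreover have "K + \<epsilon> * (2 ^ A - 1) \<le> K + \<epsilon> * 2 ^ A" for A :: nat
    using \<open>0 < \<epsilon>\<close> by simp
  ultimately show thesis using that[OF K0] by (meson order_trans)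
qed

lemma pow2_between: "1 \<le> n \<Longrightarrow> \<exists>A. n < 2 ^ A \<and> 2 ^ A \<le> 2 * (n::nat)"
proof -
  assume "1 \<le> n"
  then obtain A where "2 ^ A \<le> n" "n < 2 ^ (A + 1)" using ex_power_ivl1[of 2 n] by auto
  then show ?thesis by (intro exI[of _ "A + 1"]) simp
qed

text \<open>
  The two sums whose difference is the de la Vallee Poussin sum are estimated separately, so their
  errors have to be small compared with the length \<open>lam n + 1\<close> of the window.
\<close>

lemma vallee_poussin_deviation:
  assumes f: "integrable unit_measure f" and x: "x \<in> {0..<1}"
    and lam: "lam n \<le> n" and n: "n + 1 < 2 ^ A"
  shows "\<bar>vallee_poussin_mean lam n f x - f x\<bar>
    \<le> 2 * (\<bar>f x\<bar> + (\<Sum>a<A. 2 * 2 ^ a * flip_avg (\<lambda>t. \<bar>f t - f x\<bar>) a x)) / (real (lam n) + 1)"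
proof -
  let ?T = "\<lambda>m. \<Sum>k<m. walsh_partial_sum k f x"
  let ?B = "\<bar>f x\<bar> + (\<Sum>a<A. 2 * 2 ^ a * flip_avg (\<lambda>t. \<bar>f t - f x\<bar>) a x)"
  have "(\<Sum>k = n - lam n..n. walsh_partial_sum k f x) = ?T (n + 1) - ?T (n - lam n)"
    unfolding atLeastLessThanSuc_atLeastAtMost[symmetric]
    using sum_diff_nat_ivl[of 0 "n - lam n" "Suc n" "\<lambda>k. walsh_partial_sum k f x"]
    unfolding atLeast0LessThan Suc_eq_plus1 by linarith
  moreover have "(real (lam n) + 1) * f x = real (n + 1) * f x - real (n - lam n) * f x"
    using lam by (simp add: of_nat_diff left_diff_distrib[symmetric])
  moreover have "(real (lam n) + 1) * (vallee_poussin_mean lam n f x - f x)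
      = (\<Sum>k = n - lam n..n. walsh_partial_sum k f x) - (real (lam n) + 1) * f x"
    unfolding vallee_poussin_mean_def right_diff_distrib by simp
  ultimately have eq: "(real (lam n) + 1) * (vallee_poussin_mean lam n f x - f x)
      = (?T (n + 1) - real (n + 1) * f x) - (?T (n - lam n) - real (n - lam n) * f x)"
    by linarith
  have n': "n - lam n < 2 ^ A" using n by simp
  have diff: "\<bar>u - v\<bar> \<le> 2 * b" if "\<bar>u\<bar> \<le> b" "\<bar>v\<bar> \<le> b" for u v b :: real
    using that by linarith
  have le: "\<bar>(real (lam n) + 1) * (vallee_poussin_mean lam n f x - f x)\<bar> \<le> 2 * ?B"
    unfolding eq by (rule diff[OF sum_partial_sum_deviation[OF f x n] sum_partial_sum_deviation[OF f x n']])
  have pos: "0 < real (lam n) + 1" by simp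
  show ?thesis
    unfolding pos_le_divide_eq[OF pos]
    using le unfolding abs_mult abs_of_pos[OF pos] mult.commute[of "real (lam n) + 1"] .
qed

theorem AE_vallee_poussin_tendsto:
  fixes f :: "real \<Rightarrow> real"
  assumes lam: "\<And>n. n \<ge> 1 \<Longrightarrow> lam n \<le> n"
    and big: "(\<lambda>n. real n) \<in> O(\<lambda>n. real (lam n))" and f: "integrable unit_measure f"
  shows "AE x in unit_measure. (\<lambda>n. vallee_poussin_mean lam n f x) \<longlonglongrightarrow> f x"
proof -
  obtain c where c: "0 < c" "\<forall>\<^sub>F n in sequentially. real n \<le> c * real (lam n)"
    using big by (auto elim!: landau_o.bigE)
  show ?thesis
  proof (rule AE_mp[OF AE_flip_avg_tendsto_0[OF f]], intro AE_I2 impI)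
    fix x assume "x \<in> space unit_measure" and lim: "(\<lambda>i. flip_avg (\<lambda>t. \<bar>f t - f x\<bar>) i x) \<longlonglongrightarrow> 0"
    then have x: "x \<in> {0..<1}" by simp
    show "(\<lambda>n. vallee_poussin_mean lam n f x) \<longlonglongrightarrow> f x"
    proof (rule tendstoI)
      fix e :: real assume e: "0 < e"
      \<comment> \<open>chosen so that the error term 8 \<epsilon> c below is e / 2\<close>
      define \<epsilon> where "\<epsilon> = e / (16 * c)"
      have \<epsilon>: "0 < \<epsilon>" using e c by (simp add: \<epsilon>_def)
      obtain K where K: "0 \<le> K"
        "\<And>A. (\<Sum>a<A. 2 * 2 ^ a * flip_avg (\<lambda>t. \<bar>f t - f x\<bar>) a x) \<le> K + \<epsilon> * 2 ^ A"
        using pow2_weighted_sum_small[OF lim flip_avg_nonneg \<epsilon>] by auto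
      define M where "M = \<bar>f x\<bar> + K"
      have "(\<lambda>n. (2 * M * c) * (1 / real n)) \<longlonglongrightarrow> (2 * M * c) * 0"
        by (intro tendsto_mult tendsto_const lim_1_over_n)
      then have "\<forall>\<^sub>F n in sequentially. (2 * M * c) * (1 / real n) < e / 2"
        using e by (intro order_tendstoD(2)) auto
      then show "\<forall>\<^sub>F n in sequentially. dist (vallee_poussin_mean lam n f x) (f x) < e"
        using c(2) eventually_ge_at_top[of 1]
      proof eventually_elim
        case (elim n)
        obtain A where A: "n + 1 < 2 ^ A" "2 ^ A \<le> 2 * (n + 1)"
          using pow2_between[of "n + 1"] by auto
        have "real (2 ^ A) \<le> real (2 * (n + 1))" using A(2) by (rule of_nat_mono)
        then have A': "2 ^ A \<le> 4 * real n" using elim(3) by simp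
        have l: "0 < real (lam n)" using elim c(1) by (smt (verit) of_nat_0_le_iff mult_nonneg_nonneg mult_eq_0_iff of_nat_1 of_nat_mono)
        have "\<bar>vallee_poussin_mean lam n f x - f x\<bar> \<le> 2 * (M + \<epsilon> * 2 ^ A) / (real (lam n) + 1)"
          using K(2)[of A] unfolding M_def
          by (intro order_trans[OF vallee_poussin_deviation[of f x lam n A, OF f x lam[OF elim(3)] A(1)]] divide_right_mono) auto
        also have "\<dots> \<le> 2 * (M + \<epsilon> * (4 * real n)) / real (lam n)"
          using A' \<epsilon> l K(1) unfolding M_def by (intro frac_le mult_left_mono add_left_mono) auto
        also have "\<dots> = 2 * M / real (lam n) + 8 * \<epsilon> * (real n / real (lam n))"
          using l by (simp add: field_simps)
        also have "\<dots> \<le> (2 * M * c) * (1 / real n) + 8 * \<epsilon> * c"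
        proof (intro add_mono mult_left_mono)
          have "1 / real (lam n) \<le> c / real n" using elim l by (simp add: field_simps)
          then have "2 * M * (1 / real (lam n)) \<le> 2 * M * (c / real n)"
            using K(1) unfolding M_def by (intro mult_left_mono) auto
          then show "2 * M / real (lam n) \<le> (2 * M * c) * (1 / real n)" by simp
          show "real n / real (lam n) \<le> c" using elim l by (simp add: field_simps)
        qed (use \<epsilon> in auto)
        also have "8 * \<epsilon> * c = e / 2" using c by (simp add: \<epsilon>_def)
        finally show ?case using elim(1) by (simp add: dist_real_def)
      qed
    qed
  qed
qed

section \<open>Walsh polynomials with large oscillation of partial sums\<close>

lemma dirichlet_cong:
  assumes "\<And>k. k < N \<Longrightarrow> \<rho> k = \<sigma> k" and "n \<le> 2 ^ N"
  shows "dirichlet \<rho> n = dirichlet \<sigma> n"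
proof -
  have "wprod \<rho> k = wprod \<sigma> k" if "k < n" for k
    unfolding wprod_def
  proof (rule prod.cong[OF refl])
    fix i assume "i \<in> {i. bit k i}"
    then have "i < N" using bit_below_pow2[of k N i] that assms(2) by simp
    then show "\<rho> i = \<sigma> i" by (rule assms(1))
  qed
  then show ?thesis by (simp add: dirichlet_def)
qed

text \<open>
  The number with binary digits 1 exactly at the even positions below \<open>N\<close>.  If the first sign \<open>-1\<close> of
  \<open>\<rho>\<close> is at position \<open>a < N\<close>, then the absolute value of the Dirichlet kernel is \<open>2 ^ a\<close> minus
  \<open>alternating a\<close> for even \<open>a\<close> and \<open>alternating a\<close> for odd \<open>a\<close>, hence at least \<open>2 ^ a / 2\<close> in either
  case: no scale is lost.
\<close>

fun alternating :: "nat \<Rightarrow> nat" where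
  "alternating 0 = 0"
| "alternating (Suc N) = (if even N then alternating N + 2 ^ N else alternating N)"

lemma alternating_eq: "3 * alternating N + 1 = (if even N then 2 ^ N else 2 ^ Suc N)"
  by (induction N) auto

lemma alternating_le: "alternating N \<le> 2 ^ N"
  using alternating_eq[of N] by (auto split: if_splits)

lemma alternating_even: "even N \<Longrightarrow> 2 * real (alternating N) \<le> 2 ^ N"
proof -
  assume "even N"
  then have "2 * alternating N \<le> 2 ^ N" using alternating_eq[of N] by simp
  then have "real (2 * alternating N) \<le> real (2 ^ N)" by (rule of_nat_mono)
  then show ?thesis by simp
qed

text \<open>
  As \<open>A\<close> ranges over the subsets of \<open>{..<N}\<close>, this runs once through all patterns of the first \<open>N\<close>
  signs, whatever sequence of signs \<open>\<rho>\<close> is.  A sum over these \<open>A\<close> is thus \<open>2 ^ N\<close> times an integral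
  over the unit interval, for functions of the first \<open>N\<close> digits.
\<close>

definition negate_on :: "nat set \<Rightarrow> (nat \<Rightarrow> real) \<Rightarrow> nat \<Rightarrow> real" where
  "negate_on A \<rho> k = (if k \<in> A then - \<rho> k else \<rho> k)"

text \<open>
  The sets \<open>A\<close> and \<open>insert N A\<close> give opposite signs at position \<open>N\<close>.  For even \<open>N\<close>, the two kernels
  have absolute values \<open>\<bar>a + b\<bar>\<close> and \<open>\<bar>a - b\<bar>\<close> in some order, where \<open>b\<close> is the kernel for
  \<open>alternating N\<close> and \<open>a\<close> the one for \<open>2 ^ N\<close>.  Their sum is at least \<open>2 \<bar>b\<bar>\<close>, and for the one
  pattern without negative signs it is at least \<open>2 a = 2 ^ (N + 1)\<close>, where \<open>2 b \<le> 2 ^ N\<close>.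
\<close>

lemma sum_dirichlet_step_ge:
  assumes "signs \<rho>"
  defines "L N \<equiv> (\<Sum>A\<in>Pow {..<N}. \<bar>dirichlet (negate_on A \<rho>) (alternating N)\<bar>)"
  shows "L (Suc N) \<ge> 2 * L N + (if even N then 2 ^ N else 0)"
proof -
  let ?D = "\<lambda>A n. dirichlet (negate_on A \<rho>) n"
  have low: "?D (insert N A) n = ?D A n" if "A \<in> Pow {..<N}" "n \<le> 2 ^ N" for A n
    using that by (intro dirichlet_cong[of N]) (auto simp: negate_on_def)
  have notin: "N \<notin> A" if "A \<in> Pow {..<N}" for A using that by auto
  have "L (Suc N) = (\<Sum>A\<in>Pow {..<N} \<union> insert N ` Pow {..<N}. \<bar>?D A (alternating (Suc N))\<bar>)"
    unfolding L_def lessThan_Suc Pow_insert ..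
  also have "\<dots> = (\<Sum>A\<in>Pow {..<N}. \<bar>?D A (alternating (Suc N))\<bar>)
      + (\<Sum>A\<in>insert N ` Pow {..<N}. \<bar>?D A (alternating (Suc N))\<bar>)"
    by (rule sum.union_disjoint) auto
  also have "(\<Sum>A\<in>insert N ` Pow {..<N}. \<bar>?D A (alternating (Suc N))\<bar>)
      = (\<Sum>A\<in>Pow {..<N}. \<bar>?D (insert N A) (alternating (Suc N))\<bar>)"
  proof (intro sum.reindex_cong[of "insert N"])
    show "inj_on (insert N) (Pow {..<N})" using notin by (intro inj_onI) (metis insert_ident)
  qed auto
  finally have split: "L (Suc N) = (\<Sum>A\<in>Pow {..<N}. \<bar>?D A (alternating (Suc N))\<bar>
      + \<bar>?D (insert N A) (alternating (Suc N))\<bar>)"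
    by (simp add: sum.distrib)
  show ?thesis
  proof (cases "even N")
    case False
    then have "L (Suc N) = (\<Sum>A\<in>Pow {..<N}. 2 * \<bar>?D A (alternating N)\<bar>)"
      unfolding split by (intro sum.cong) (auto simp: low alternating_le)
    then show ?thesis using False by (simp add: L_def sum_distrib_left)
  next
    case True
    define Z where "Z = {k. k < N \<and> \<rho> k = - 1}"
    have Z: "Z \<in> Pow {..<N}" by (auto simp: Z_def)
    have ones: "\<forall>k<N. negate_on Z \<rho> k = 1"
      using signsD[OF assms(1)] by (auto simp: negate_on_def Z_def)
    have step: "2 * \<bar>?D A (alternating N)\<bar> + (if A = Z then 2 ^ N else 0)
        \<le> \<bar>?D A (alternating (Suc N))\<bar> + \<bar>?D (insert N A) (alternating (Suc N))\<bar>"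
      if A: "A \<in> Pow {..<N}" for A
    proof -
      let ?a = "?D A (2 ^ N)" and ?b = "?D A (alternating N)"
      have "?D B (alternating (Suc N)) = ?D B (2 ^ N) + negate_on B \<rho> N * ?D B (alternating N)" for B
        using dirichlet_add[of N "2 ^ N" "alternating N" "negate_on B \<rho>"] True
        by (simp add: alternating_le add.commute)
      then have "?D A (alternating (Suc N)) = ?a + \<rho> N * ?b"
        and "?D (insert N A) (alternating (Suc N)) = ?a - \<rho> N * ?b"
        using low[OF A] notin[OF A] by (simp_all add: negate_on_def alternating_le)
      then have eq: "\<bar>?D A (alternating (Suc N))\<bar> + \<bar>?D (insert N A) (alternating (Suc N))\<bar>
          = \<bar>?a + ?b\<bar> + \<bar>?a - ?b\<bar>"
        using signsD[OF assms(1), of N] by auto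
      show ?thesis
      proof (cases "A = Z")
        case True
        then have "?a = 2 ^ N" "?b = real (alternating N)"
          using dirichlet_all_ones[OF ones, of "2 ^ N"] dirichlet_all_ones[OF ones alternating_le] by simp_all
        then show ?thesis unfolding eq using alternating_even[OF \<open>even N\<close>] True by simp
      next
        case False
        then show ?thesis unfolding eq by simp
      qed
    qed
    have "2 * L N + 2 ^ N = (\<Sum>A\<in>Pow {..<N}. 2 * \<bar>?D A (alternating N)\<bar> + (if A = Z then 2 ^ N else 0))"
      using Z by (simp add: L_def sum.distrib sum_distrib_left sum.delta')
    also have "\<dots> \<le> L (Suc N)" unfolding split by (rule sum_mono) (rule step)
    finally show ?thesis using True by simp
  qed
qed

text \<open>
  The Lebesgue constants of the Walsh system grow logarithmically along \<open>alternating N\<close>.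
\<close>

lemma sum_dirichlet_ge:
  assumes "signs \<rho>"
  shows "2 ^ N * (real N / 4) \<le> (\<Sum>A\<in>Pow {..<N}. \<bar>dirichlet (negate_on A \<rho>) (alternating N)\<bar>)"
proof -
  have "2 ^ N * (real ((N + 1) div 2) / 2) \<le> (\<Sum>A\<in>Pow {..<N}. \<bar>dirichlet (negate_on A \<rho>) (alternating N)\<bar>)"
  proof (induction N)
    case (Suc N)
    have "2 ^ Suc N * (real ((Suc N + 1) div 2) / 2) = 2 * (2 ^ N * (real ((N + 1) div 2) / 2)) + (if even N then 2 ^ N else 0)"
      by (cases "even N") (auto elim!: evenE oddE simp: field_simps)
    then show ?case using Suc.IH sum_dirichlet_step_ge[OF assms, of N] by linarith
  qed simp
  moreover have "real N / 4 \<le> real ((N + 1) div 2) / 2" by linarith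
  ultimately show ?thesis
    by (meson mult_left_mono order_trans zero_le_numeral zero_le_power)
qed

lemma ex_nat_with_bits: "finite K \<Longrightarrow> \<exists>h::nat. \<forall>k. bit h k \<longleftrightarrow> k \<in> K"
proof (induction K rule: finite_induct)
  case empty
  have "\<forall>k. bit (0::nat) k \<longleftrightarrow> k \<in> {}" by simp
  then show ?case by blast
next
  case (insert a K)
  then obtain h :: nat where "\<forall>k. bit h k \<longleftrightarrow> k \<in> K" by blast
  then have "\<forall>k. bit (set_bit a h) k \<longleftrightarrow> k \<in> insert a K" by (auto simp: bit_set_bit_iff)
  then show ?case by blast
qed

text \<open>
  The polynomial is an average of \<open>2 ^ N\<close> point masses \<open>\<tau> A\<close>, smoothed to level \<open>M\<close>, with one mass
  for each pattern \<open>A\<close> of the first \<open>N\<close> digits.  Besides the pattern, \<open>\<tau> A\<close> has a private digit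
  \<open>N + e A\<close> equal to 1.  By \<open>dirichlet_add\<close>, the partial sums of orders \<open>h + l\<close> and \<open>h\<close> differ by the
  average over \<open>A\<close> of \<open>w\<^sub>h\<close> times the Dirichlet kernel of order \<open>l = alternating N\<close> centred at \<open>\<tau> A\<close>.
  The private digits make it possible to choose \<open>h\<close>, depending on the point \<open>\<rho>\<close>, so that \<open>w\<^sub>h\<close> has
  the sign of this kernel for every \<open>A\<close> at once.  Up to sign, the difference is then the full \<open>L\<^sub>1\<close>
  norm of the kernel.  The kernel of order \<open>l\<close> sees only the first \<open>N\<close> digits, so the mass nearest to
  the point needs no separate treatment, and the bound holds at every point.
\<close>

lemma kolmogorov_block:
  obtains c :: "nat \<Rightarrow> real" and M :: nat where "c 0 = 1"
    and "\<And>\<rho>. signs \<rho> \<Longrightarrow> 0 \<le> (\<Sum>q<2 ^ M. c q * wprod \<rho> q)"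
    and "\<And>\<rho>. signs \<rho> \<Longrightarrow> \<exists>p q. 2 \<le> p \<and> p \<le> 2 ^ M \<and> 2 \<le> q \<and> q \<le> 2 ^ M \<and>
      real N / 4 \<le> \<bar>(\<Sum>i<p. c i * wprod \<rho> i) - (\<Sum>i<q. c i * wprod \<rho> i)\<bar>"
proof -
  define S where "S = Pow {..<N}"
  have S: "finite S" "card S = 2 ^ N" by (simp_all add: S_def card_Pow)
  obtain e where e: "bij_betw e S {0..<2 ^ N :: nat}"
    using ex_bij_betw_finite_nat[OF S(1)] S(2) by auto
  then have einj: "inj_on e S" and elt: "\<And>A. A \<in> S \<Longrightarrow> e A < 2 ^ N"
    by (auto simp: bij_betw_def)
  define \<tau> where "\<tau> A k = (if k < N \<and> k \<in> A \<or> k = N + e A then - 1 else 1 :: real)" for A k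
  have \<tau>: "signs (\<tau> A)" for A by (simp add: signs_def \<tau>_def)
  \<comment> \<open>besides the pattern digits and the private digits, one further digit, 0 for every mass\<close>
  define M where "M = N + 2 ^ N + 1"
  define c where "c q = (\<Sum>A\<in>S. wprod (\<tau> A) q) / 2 ^ N" for q
  have poly: "(\<Sum>q<n. c q * wprod \<rho> q) = (\<Sum>A\<in>S. dirichlet (\<lambda>k. \<rho> k * \<tau> A k) n) / 2 ^ N" for n \<rho>
  proof -
    have "(\<Sum>q<n. c q * wprod \<rho> q) = (\<Sum>q<n. \<Sum>A\<in>S. wprod \<rho> q * wprod (\<tau> A) q / 2 ^ N)"
      by (simp add: c_def sum_divide_distrib sum_distrib_left mult.commute)
    also have "\<dots> = (\<Sum>A\<in>S. \<Sum>q<n. wprod \<rho> q * wprod (\<tau> A) q / 2 ^ N)" by (rule sum.swap)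
    also have "\<dots> = (\<Sum>A\<in>S. dirichlet (\<lambda>k. \<rho> k * \<tau> A k) n) / 2 ^ N"
      by (simp add: dirichlet_def wprod_mult sum_divide_distrib)
    finally show ?thesis .
  qed
  show thesis
  proof
    show "c 0 = 1" by (simp add: c_def S(2))
    fix \<rho> :: "nat \<Rightarrow> real" assume \<rho>: "signs \<rho>"
    show "0 \<le> (\<Sum>q<2 ^ M. c q * wprod \<rho> q)"
      unfolding poly by (intro divide_nonneg_nonneg sum_nonneg) (simp_all add: dirichlet_pow2_signs signs_mult \<rho> \<tau>)
    define l where "l = alternating N"
    let ?\<sigma> = "\<lambda>A k. \<rho> k * \<tau> A k"
    have Dl: "dirichlet (?\<sigma> A) l = dirichlet (negate_on A \<rho>) l" if "A \<in> S" for A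
      unfolding l_def by (rule dirichlet_cong[OF _ alternating_le]) (auto simp: \<tau>_def negate_on_def)
    \<comment> \<open>private digits where the sign has to be reversed; the top digit makes \<open>h \<ge> 2\<close>\<close>
    define K where "K = insert (M - 1) ((\<lambda>A. N + e A) ` {A \<in> S. dirichlet (?\<sigma> A) l < 0})"
    have "finite K" using S(1) by (simp add: K_def)
    then obtain h :: nat where h: "\<And>k. bit h k \<longleftrightarrow> k \<in> K" using ex_nat_with_bits by metis
    have Krange: "N \<le> k" "k < M" if "k \<in> K" for k
      using that elt by (auto simp: K_def M_def less_Suc_eq)
    have hN: "2 ^ N dvd h"
      unfolding take_bit_eq_0_iff[symmetric]
      using h Krange(1) by (auto simp: bit_eq_iff bit_simps simp flip: not_le)
    have "take_bit M h = h"
      using h Krange(2) by (auto simp: bit_eq_iff bit_simps)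
    then have hM: "h < 2 ^ M" by (metis take_bit_nat_less_exp)
    have "2 ^ (M - 1) \<le> h"
    proof (rule ccontr)
      assume "\<not> 2 ^ (M - 1) \<le> h"
      moreover have "bit h (M - 1)" unfolding h K_def by simp
      ultimately show False using bit_below_pow2[of h "M - 1" "M - 1"] by simp
    qed
    moreover have "(2::nat) ^ 1 \<le> 2 ^ (M - 1)" by (rule power_increasing) (simp_all add: M_def Suc_leI)
    ultimately have h2: "2 \<le> h" by simp
    have hl: "h + l \<le> 2 ^ M"
    proof -
      have "2 ^ N dvd (2 ^ M :: nat)" by (rule le_imp_power_dvd) (simp add: M_def)
      then have "2 ^ N dvd 2 ^ M - h" using hN by (rule dvd_diff_nat)
      then have "2 ^ N \<le> 2 ^ M - h" using hM by (intro dvd_imp_le) auto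
      then show ?thesis using alternating_le[of N] hM unfolding l_def by linarith
    qed
    have sign: "wprod (\<tau> A) h * dirichlet (?\<sigma> A) l = \<bar>dirichlet (?\<sigma> A) l\<bar>" if A: "A \<in> S" for A
    proof -
      have "wprod (\<tau> A) h = (\<Prod>k | bit h k. if k = N + e A then - 1 else 1)"
        unfolding wprod_def using h Krange(1) by (intro prod.cong) (auto simp: \<tau>_def simp flip: not_le)
      also have "\<dots> = (if N + e A \<in> K then - 1 else 1)"
        using finite_bits[of h] h by (simp add: prod.delta)
      also have "N + e A \<in> K \<longleftrightarrow> dirichlet (?\<sigma> A) l < 0"
        using elt[OF A] A by (auto simp: K_def M_def dest: inj_onD[OF einj])
      finally show ?thesis by simp
    qed
    have "(\<Sum>i<h + l. c i * wprod \<rho> i) - (\<Sum>i<h. c i * wprod \<rho> i)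
        = (\<Sum>A\<in>S. wprod (?\<sigma> A) h * dirichlet (?\<sigma> A) l) / 2 ^ N"
      unfolding poly using dirichlet_add[OF hN, of l] alternating_le[of N]
      by (simp add: l_def diff_divide_distrib[symmetric] sum_subtractf[symmetric])
    also have "\<dots> = wprod \<rho> h * ((\<Sum>A\<in>S. \<bar>dirichlet (?\<sigma> A) l\<bar>) / 2 ^ N)"
      by (simp add: wprod_mult sum_distrib_left mult.assoc sign)
    finally have eq: "(\<Sum>i<h + l. c i * wprod \<rho> i) - (\<Sum>i<h. c i * wprod \<rho> i)
        = wprod \<rho> h * ((\<Sum>A\<in>S. \<bar>dirichlet (?\<sigma> A) l\<bar>) / 2 ^ N)" .
    have "2 ^ N * (real N / 4) \<le> (\<Sum>A\<in>S. \<bar>dirichlet (?\<sigma> A) l\<bar>)"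
      using sum_dirichlet_ge[OF \<rho>, of N] Dl by (simp add: S_def l_def)
    then have "real N / 4 \<le> (\<Sum>A\<in>S. \<bar>dirichlet (?\<sigma> A) l\<bar>) / 2 ^ N"
      by (simp add: field_simps)
    then have "real N / 4 \<le> \<bar>(\<Sum>i<h + l. c i * wprod \<rho> i) - (\<Sum>i<h. c i * wprod \<rho> i)\<bar>"
      unfolding eq using wprod_sign[OF \<rho>, of h] by (auto simp: abs_mult)
    then show "\<exists>p q. 2 \<le> p \<and> p \<le> 2 ^ M \<and> 2 \<le> q \<and> q \<le> 2 ^ M \<and>
      real N / 4 \<le> \<bar>(\<Sum>i<p. c i * wprod \<rho> i) - (\<Sum>i<q. c i * wprod \<rho> i)\<bar>"
      using h2 hl hM by (intro exI[of _ "h + l"] exI[of _ h]) auto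
  qed
qed

section \<open>A lacunary series of shifted Walsh polynomials\<close>

lemma wprod_shift: "wprod \<rho> (2 ^ s * q) = wprod (\<lambda>k. \<rho> (k + s)) q"
proof -
  have "{k. bit (2 ^ s * q) k} = (\<lambda>k. k + s) ` {k. bit q k}"
  proof -
    have "bit (2 ^ s * q) k \<longleftrightarrow> s \<le> k \<and> bit q (k - s)" for k
      using bit_push_bit_iff[of s q k] by (simp add: push_bit_eq_mult mult.commute)
    then show ?thesis by (force simp: image_iff intro: le_add_diff_inverse2[symmetric])
  qed
  then show ?thesis by (simp add: wprod_def prod.reindex)
qed

lemma walsh_shift: "walsh (2 ^ s * q) x = wprod (\<lambda>k. rademacher (k + s) x) q"
  by (simp add: walsh_eq_wprod wprod_shift)

lemma signs_rademacher_shift: "signs (\<lambda>k. rademacher (k + s) x)"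
  by (simp add: signs_def rademacher_cases)

text \<open>
  The polynomials are nonnegative and have integral \<open>c j 0 = 1\<close>, so the weights \<open>2 ^ (-j)\<close> make the
  series converge in \<open>L\<^sub>1\<close>, and almost everywhere by monotone convergence.  The spectrum of the
  \<open>j\<close>-th term consists of 0 and of numbers in \<open>{2 ^ s j..<2 ^ (s j + M j)}\<close>; these intervals are
  disjoint, so the Fourier coefficients can be read off one term.
\<close>

lemma lacunary_walsh_series:
  fixes c :: "nat \<Rightarrow> nat \<Rightarrow> real" and s M :: "nat \<Rightarrow> nat"
  assumes c0: "\<And>j. c j 0 = 1"
    and nonneg: "\<And>j \<rho>. signs \<rho> \<Longrightarrow> 0 \<le> (\<Sum>q<2 ^ M j. c j q * wprod \<rho> q)"
    and gap: "\<And>i j. i < j \<Longrightarrow> s i + M i \<le> s j"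
  obtains f where "integrable unit_measure f"
    and "\<And>j k. 2 ^ s j \<le> k \<Longrightarrow> k < 2 ^ (s j + M j) \<Longrightarrow>
      walsh_coeff f k = (if 2 ^ s j dvd k then (1 / 2) ^ j * c j (k div 2 ^ s j) else 0)"
proof -
  define P where "P j x = (\<Sum>q<2 ^ M j. c j q * walsh (2 ^ s j * q) x)" for j x
  have P0: "0 \<le> P j x" for j x
    unfolding P_def walsh_shift by (rule nonneg) (rule signs_rademacher_shift)
  have coeff: "(\<integral>x. P j x * walsh k x \<partial>unit_measure) = (\<Sum>q<2 ^ M j. c j q * of_bool (2 ^ s j * q = k))"
    and int: "integrable unit_measure (\<lambda>x. P j x * walsh k x)" for j k
  proof -
    have i: "integrable unit_measure (\<lambda>x. c j q * (walsh (2 ^ s j * q) x * walsh k x))" for q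
      by (intro integrable_mult_right integrable_mult_walsh integrable_walsh)
    have eq: "P j x * walsh k x = (\<Sum>q<2 ^ M j. c j q * (walsh (2 ^ s j * q) x * walsh k x))" for x
      by (simp add: P_def sum_distrib_right mult.assoc)
    show "integrable unit_measure (\<lambda>x. P j x * walsh k x)"
      unfolding eq by (intro Bochner_Integration.integrable_sum i)
    show "(\<integral>x. P j x * walsh k x \<partial>unit_measure) = (\<Sum>q<2 ^ M j. c j q * of_bool (2 ^ s j * q = k))"
      unfolding eq Bochner_Integration.integral_sum[OF i]
      by (simp only: integral_mult_right_zero integral_walsh_walsh)
  qed
  have w0: "walsh 0 x = 1" for x by (simp add: walsh_eq_wprod)
  have Pi: "integrable unit_measure (P j)" for j using int[of j 0] by (simp add: w0)
  have PI: "(\<integral>x. P j x \<partial>unit_measure) = 1" for j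
  proof -
    have "(\<integral>x. P j x \<partial>unit_measure) = (\<Sum>q<2 ^ M j. if q = 0 then c j q else 0)"
      using coeff[of j 0] by (simp add: w0 of_bool_def if_distrib cong: if_cong)
    then show ?thesis using c0 by (simp add: sum.delta)
  qed
  define T where "T j x = (1 / 2) ^ j * P j x" for j x
  have T0: "0 \<le> T j x" for j x unfolding T_def using P0 by simp
  have Ti: "integrable unit_measure (T j)" for j unfolding T_def[abs_def] using Pi by simp
  have geo: "summable (\<lambda>j. (1 / 2 :: real) ^ j)" by (rule summable_geometric) simp
  have AEsum: "AE x in unit_measure. summable (\<lambda>j. T j x)"
  proof -
    have Tm: "T j \<in> borel_measurable unit_measure" for j using Ti by (rule borel_measurable_integrable)
    have Tn: "(\<integral>\<^sup>+x. ennreal (T j x) \<partial>unit_measure) = ennreal ((1 / 2) ^ j)" for j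
      using nn_integral_eq_integral[OF Ti[of j]] T0 PI[of j] by (simp add: T_def[abs_def])
    have "(\<integral>\<^sup>+x. (\<Sum>j. ennreal (T j x)) \<partial>unit_measure) = (\<Sum>j. \<integral>\<^sup>+x. ennreal (T j x) \<partial>unit_measure)"
      using Tm by (intro nn_integral_suminf) measurable
    also have "\<dots> = (\<Sum>j. ennreal ((1 / 2) ^ j))" by (simp only: Tn)
    also have "\<dots> \<noteq> \<infinity>"
      unfolding infinity_ennreal_def by (rule ennreal_suminf_neq_top[OF geo]) simp
    finally have "AE x in unit_measure. (\<Sum>j. ennreal (T j x)) \<noteq> \<infinity>"
      using Tm by (intro nn_integral_PInf_AE) measurable
    then show ?thesis
    proof eventually_elim
      case (elim x)
      show ?case
        by (rule summable_suminf_not_top) (use T0 elim in \<open>simp_all only: infinity_ennreal_def simp_thms\<close>)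
    qed
  qed
  define f where "f x = (\<Sum>j. T j x)" for x
  have Tw: "integrable unit_measure (\<lambda>x. T j x * walsh k x)" for j k
    by (intro integrable_mult_walsh Ti)
  have norm: "norm (T j x * walsh k x) = T j x" for j k x
    using T0[of j x] by (simp add: abs_mult walsh_abs)
  have TI: "(\<integral>x. T j x \<partial>unit_measure) = (1 / 2) ^ j" for j
    using PI[of j] by (simp add: T_def[abs_def])
  have sums: "(\<lambda>j. \<integral>x. T j x * walsh k x \<partial>unit_measure) sums (\<integral>x. (\<Sum>j. T j x * walsh k x) \<partial>unit_measure)"
    and fint: "integrable unit_measure (\<lambda>x. \<Sum>j. T j x * walsh k x)" for k
    using AEsum geo by (intro sums_integral integrable_suminf Tw; simp only: norm TI)+
  have fw: "walsh_coeff f k = (\<integral>x. (\<Sum>j. T j x * walsh k x) \<partial>unit_measure)" for k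
    unfolding walsh_coeff_def
  proof (rule integral_cong_AE)
    show "AE x in unit_measure. f x * walsh k x = (\<Sum>j. T j x * walsh k x)"
      using AEsum by eventually_elim (simp add: f_def suminf_mult2)
    show "(\<lambda>x. \<Sum>j. T j x * walsh k x) \<in> borel_measurable unit_measure"
      by (rule borel_measurable_integrable[OF fint])
    show "(\<lambda>x. f x * walsh k x) \<in> borel_measurable unit_measure"
      unfolding f_def
      by (intro borel_measurable_times borel_measurable_suminf borel_measurable_integrable[OF Ti]
          borel_imp_unit_measurable walsh_measurable_borel)
  qed
  show thesis
  proof
    show "integrable unit_measure f"
      using fint[of 0] by (simp add: w0 f_def[abs_def])
    fix j k :: nat
    assume k: "2 ^ s j \<le> k" "k < 2 ^ (s j + M j)"
    define d where "d i = (\<integral>x. T i x * walsh k x \<partial>unit_measure)" for i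
    have d: "d i = (1 / 2) ^ i * (\<Sum>q<2 ^ M i. c i q * of_bool (2 ^ s i * q = k))" for i
      unfolding d_def T_def mult.assoc by (simp only: integral_mult_right_zero coeff)
    have other: "d i = 0" if "i \<noteq> j" for i
    proof -
      have "2 ^ s i * q \<noteq> k" if q: "q < 2 ^ M i" for q
      proof (cases "i < j")
        case True
        have "2 ^ s i * q < 2 ^ s i * 2 ^ M i" using q by simp
        also have "\<dots> \<le> 2 ^ s j" using gap[OF True] by (simp add: power_add[symmetric])
        finally show ?thesis using k by simp
      next
        case False
        then have ji: "j < i" using \<open>i \<noteq> j\<close> by simp
        have "(2::nat) ^ (s j + M j) \<le> 2 ^ s i" using gap[OF ji] by simp
        then have "k < 2 ^ s i" using k(2) by linarith
        moreover have "0 < k" by (rule less_le_trans[OF _ k(1)]) simp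
        moreover have "2 ^ s i * 1 \<le> 2 ^ s i * q" if "q \<noteq> 0" using that by (intro mult_le_mono2) simp
        ultimately show ?thesis by (cases "q = 0") auto
      qed
      then show ?thesis unfolding d by (simp add: sum.neutral)
    qed
    have "(\<Sum>q<2 ^ M j. c j q * of_bool (2 ^ s j * q = k)) = (if 2 ^ s j dvd k then c j (k div 2 ^ s j) else 0)"
    proof (cases "2 ^ s j dvd k")
      case True
      then obtain p where p: "k = 2 ^ s j * p" by blast
      have "p < 2 ^ M j" using k(2) unfolding p by (simp add: power_add)
      then have "(\<Sum>q<2 ^ M j. if q = p then c j q else 0) = c j p" by (simp add: sum.delta)
      then show ?thesis using True unfolding p by (simp add: of_bool_def if_distrib cong: if_cong)
    next
      case False
      then show ?thesis by (auto intro!: sum.neutral)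
    qed
    then have dj: "d j = (if 2 ^ s j dvd k then (1 / 2) ^ j * c j (k div 2 ^ s j) else 0)"
      unfolding d by simp
    have "d sums d j" using sums_finite[of "{j}" d] other by simp
    moreover have "d sums walsh_coeff f k" unfolding fw d_def[abs_def] by (rule sums)
    ultimately have "walsh_coeff f k = d j" by (rule sums_unique2[symmetric])
    then show "walsh_coeff f k = (if 2 ^ s j dvd k then (1 / 2) ^ j * c j (k div 2 ^ s j) else 0)"
      using dj by simp
  qed
qed

lemma partial_sum_eq_of_coeff_0:
  assumes "m \<le> n" and "\<And>i. m \<le> i \<Longrightarrow> i < n \<Longrightarrow> walsh_coeff f i = 0"
  shows "walsh_partial_sum m f x = walsh_partial_sum n f x"
  unfolding walsh_partial_sum_def using assms by (intro sum.mono_neutral_left) auto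

text \<open>
  A gap in the spectrum that covers the averaging window makes all the averaged partial sums equal.
\<close>

lemma vallee_poussin_eq_partial_sum:
  assumes "lam n \<le> n" and "\<And>i. n - lam n \<le> i \<Longrightarrow> i < n \<Longrightarrow> walsh_coeff f i = 0"
  shows "vallee_poussin_mean lam n f x = walsh_partial_sum n f x"
proof -
  have "(\<Sum>k = n - lam n..n. walsh_partial_sum k f x) = (\<Sum>k = n - lam n..n. walsh_partial_sum n f x)"
    using assms(2) by (intro sum.cong partial_sum_eq_of_coeff_0) auto
  also have "\<dots> = (real (lam n) + 1) * walsh_partial_sum n f x"
    using assms(1) by (simp add: Suc_diff_diff of_nat_diff)
  finally show ?thesis by (simp add: vallee_poussin_mean_def)
qed

lemma partial_sum_block:
  assumes coeff: "\<And>k. 2 ^ s \<le> k \<Longrightarrow> k < 2 ^ (s + M) \<Longrightarrow>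
      walsh_coeff f k = (if 2 ^ s dvd k then b * c (k div 2 ^ s) else 0)"
    and "1 \<le> q" and "q \<le> 2 ^ M"
  shows "walsh_partial_sum (2 ^ s * q) f x
    = walsh_partial_sum (2 ^ s) f x + b * ((\<Sum>i<q. c i * walsh (2 ^ s * i) x) - c 0)"
  using assms(2,3)
proof (induction q rule: dec_induct)
  case base
  then show ?case by (simp add: walsh_eq_wprod)
next
  case (step q)
  let ?m = "2 ^ s * q"
  have top: "?m + 2 ^ s \<le> 2 ^ (s + M)"
  proof -
    have "2 ^ s * Suc q \<le> 2 ^ s * 2 ^ M" using step.prems by (intro mult_le_mono2)
    then show ?thesis by (simp add: power_add)
  qed
  have lo: "2 ^ s \<le> ?m" using step.hyps by simp
  have mlt: "?m < 2 ^ (s + M)" by (rule less_le_trans[OF _ top]) simp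
  have "walsh_partial_sum (2 ^ s * Suc q) f x = walsh_partial_sum (Suc ?m) f x"
  proof (rule partial_sum_eq_of_coeff_0[symmetric])
    show "Suc ?m \<le> 2 ^ s * Suc q" by (simp add: Suc_le_eq)
    fix i assume i: "Suc ?m \<le> i" "i < 2 ^ s * Suc q"
    have "\<not> 2 ^ s dvd i"
    proof
      assume "2 ^ s dvd i"
      then obtain p where p: "i = 2 ^ s * p" by blast
      have "q < p" "p < Suc q" using i unfolding p by (simp_all add: Suc_le_eq del: mult_Suc_right)
      then show False by simp
    qed
    then show "walsh_coeff f i = 0" using coeff[of i] i lo top by simp
  qed
  also have "\<dots> = walsh_partial_sum ?m f x + walsh_coeff f ?m * walsh ?m x"
    by (simp add: walsh_partial_sum_def)
  also have "walsh_coeff f ?m = b * c q" using coeff[OF lo mlt] by simp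
  finally show ?case using step.IH step.prems by (simp add: algebra_simps)
qed

text \<open>
  The dilation exponents \<open>s j\<close> are so large that \<open>lam n < 2 ^ s j\<close> for all \<open>n = 2 ^ s j * q\<close> with
  \<open>1 \<le> q \<le> 2 ^ M j\<close>, and that the spectra of the blocks are separated.  The means at such \<open>n\<close> with
  \<open>q \<ge> 2\<close> are partial sums, and two of them differ by at least \<open>2 ^ (-j) 2 ^ j = 1\<close> at each point, so
  they do not form a Cauchy sequence.
\<close>

theorem divergent_vallee_poussin:
  fixes lam :: "nat \<Rightarrow> nat"
  assumes lam: "\<And>n. n \<ge> 1 \<Longrightarrow> 1 \<le> lam n \<and> lam n \<le> n"
    and lim: "filterlim (\<lambda>n. real n / real (lam n)) at_top sequentially"
  obtains f where "integrable unit_measure f"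
    and "\<And>x. \<not> convergent (\<lambda>n. vallee_poussin_mean lam n f x)"
proof -
  define good where "good j c M \<longleftrightarrow> c 0 = (1 :: real) \<and>
      (\<forall>\<rho>. signs \<rho> \<longrightarrow> 0 \<le> (\<Sum>q<2 ^ M. c q * wprod \<rho> q)) \<and>
      (\<forall>\<rho>. signs \<rho> \<longrightarrow> (\<exists>p q. 2 \<le> p \<and> p \<le> 2 ^ M \<and> 2 \<le> q \<and> q \<le> 2 ^ M \<and>
      2 ^ j \<le> \<bar>(\<Sum>i<p. c i * wprod \<rho> i) - (\<Sum>i<q. c i * wprod \<rho> i)\<bar>))" for j c and M :: nat
  have ex: "\<exists>c M. good j c M" for j
  proof -
    have eq: "real (4 * 2 ^ j) / 4 = 2 ^ j" by simp
    show ?thesis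
    proof (rule kolmogorov_block[of "4 * 2 ^ j", unfolded eq])
      fix c :: "nat \<Rightarrow> real" and M :: nat
      assume "c 0 = 1" and "\<And>\<rho>. signs \<rho> \<Longrightarrow> 0 \<le> (\<Sum>q<2 ^ M. c q * wprod \<rho> q)"
        and "\<And>\<rho>. signs \<rho> \<Longrightarrow> \<exists>p q. 2 \<le> p \<and> p \<le> 2 ^ M \<and> 2 \<le> q \<and> q \<le> 2 ^ M \<and>
          2 ^ j \<le> \<bar>(\<Sum>i<p. c i * wprod \<rho> i) - (\<Sum>i<q. c i * wprod \<rho> i)\<bar>"
      then have "good j c M" unfolding good_def by simp
      then show ?thesis by blast
    qed
  qed
  obtain c M where "\<And>j. good j (c j) (M j)" using ex by metis
  then have c0: "\<And>j. c j 0 = 1"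
    and nonneg: "\<And>j \<rho>. signs \<rho> \<Longrightarrow> 0 \<le> (\<Sum>q<2 ^ M j. c j q * wprod \<rho> q)"
    and osc: "\<And>j \<rho>. signs \<rho> \<Longrightarrow> \<exists>p q. 2 \<le> p \<and> p \<le> 2 ^ M j \<and> 2 \<le> q \<and> q \<le> 2 ^ M j \<and>
      2 ^ j \<le> \<bar>(\<Sum>i<p. c j i * wprod \<rho> i) - (\<Sum>i<q. c j i * wprod \<rho> i)\<bar>"
    unfolding good_def by blast+
  have "\<exists>t. \<forall>n\<ge>2 ^ t. lam n * 2 ^ M j < n" for j
  proof -
    have "\<forall>\<^sub>F n in sequentially. 2 ^ M j < real n / real (lam n)"
      using lim by (simp add: filterlim_at_top_dense)
    then obtain t where t: "\<And>n. t \<le> n \<Longrightarrow> 2 ^ M j < real n / real (lam n)"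
      by (auto simp: eventually_sequentially)
    have "lam n * 2 ^ M j < n" if "2 ^ t \<le> n" for n
    proof -
      have "t < 2 ^ t" by simp
      then have n: "t \<le> n" "1 \<le> n" using that by linarith+
      then have "2 ^ M j * real (lam n) < real n"
        using t[of n] lam[of n] by (simp add: pos_less_divide_eq)
      then have "real (2 ^ M j * lam n) < real n" by simp
      then show ?thesis by (simp only: of_nat_less_iff mult.commute)
    qed
    then show ?thesis by blast
  qed
  then obtain t where t: "\<And>j n. 2 ^ t j \<le> n \<Longrightarrow> lam n * 2 ^ M j < n" by metis
  \<comment> \<open>the first sum ensures t j \<le> s j, the second one separates the blocks and makes s j tend to infinity\<close>
  define s where "s j = (\<Sum>i\<le>j. t i) + (\<Sum>i<j. Suc (M i))" for j
  have ts: "t j \<le> s j" for j unfolding s_def by (simp add: lessThan_Suc_atMost[symmetric])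
  have js: "j \<le> s j" for j
  proof -
    have "(\<Sum>i<j. 1) \<le> (\<Sum>i<j. Suc (M i))" by (intro sum_mono) simp
    then show ?thesis by (simp add: s_def)
  qed
  have gap: "s i + M i \<le> s j" if "i < j" for i j
    using that
  proof (induction j)
    case (Suc j)
    have "s j + M j \<le> s (Suc j)" unfolding s_def by simp
    moreover have "s i + M i \<le> s j" if "i \<noteq> j" using Suc that by simp
    ultimately show ?case by (cases "i = j") auto
  qed simp
  obtain f where f: "integrable unit_measure f"
    and coeff: "\<And>j k. 2 ^ s j \<le> k \<Longrightarrow> k < 2 ^ (s j + M j) \<Longrightarrow>
      walsh_coeff f k = (if 2 ^ s j dvd k then (1 / 2) ^ j * c j (k div 2 ^ s j) else 0)"
    using lacunary_walsh_series[of c M s, OF c0 nonneg gap] by blast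
  have VP: "vallee_poussin_mean lam (2 ^ s j * q) f x = walsh_partial_sum (2 ^ s j) f x
      + (1 / 2) ^ j * ((\<Sum>i<q. c j i * walsh (2 ^ s j * i) x) - c j 0)"
    if q: "2 \<le> q" "q \<le> 2 ^ M j" for j q x
  proof -
    let ?n = "2 ^ s j * q"
    have n1: "1 \<le> ?n" using q by simp
    have "(2::nat) ^ t j \<le> 2 ^ s j" using ts by simp
    then have "2 ^ t j \<le> ?n" using q by (metis le_trans mult.right_neutral mult_le_mono2 one_le_numeral)
    then have "lam ?n * 2 ^ M j < ?n" by (rule t)
    also have "\<dots> \<le> 2 ^ s j * 2 ^ M j" using q by (intro mult_le_mono2)
    finally have l: "lam ?n < 2 ^ s j" by simp
    have zero: "walsh_coeff f i = 0" if i: "?n - lam ?n \<le> i" "i < ?n" for i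
    proof -
      \<comment> \<open>the window lies strictly between two consecutive multiples of 2 ^ s j\<close>
      have above: "2 ^ s j * (q - 1) < i"
      proof -
        have "2 ^ s j * (q - 1) + 2 ^ s j = ?n" using q by (cases q) auto
        then show ?thesis using i(1) l by linarith
      qed
      have "\<not> 2 ^ s j dvd i"
      proof
        assume "2 ^ s j dvd i"
        then obtain p where p: "i = 2 ^ s j * p" by blast
        have "q - 1 < p" "p < q" using above i(2) unfolding p by simp_all
        then show False by simp
      qed
      moreover have "2 ^ s j \<le> i"
      proof -
        have "2 ^ s j * 1 \<le> 2 ^ s j * (q - 1)" using q by (intro mult_le_mono2) simp
        then show ?thesis using above unfolding mult_1_right by (rule order_trans[OF _ less_imp_le])
      qed
      moreover have "i < 2 ^ (s j + M j)"
      proof -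
        have "?n \<le> 2 ^ s j * 2 ^ M j" using q by (intro mult_le_mono2)
        from less_le_trans[OF i(2) this] show ?thesis by (simp only: power_add)
      qed
      ultimately show ?thesis using coeff[of j i] by simp
    qed
    have "vallee_poussin_mean lam ?n f x = walsh_partial_sum ?n f x"
      using lam[OF n1] zero by (intro vallee_poussin_eq_partial_sum) auto
    also have "\<dots> = walsh_partial_sum (2 ^ s j) f x
      + (1 / 2) ^ j * ((\<Sum>i<q. c j i * walsh (2 ^ s j * i) x) - c j 0)"
      using q by (intro partial_sum_block[where M = "M j"] coeff) auto
    finally show ?thesis .
  qed
  show thesis
  proof
    show "integrable unit_measure f" by (rule f)
    fix x
    show "\<not> convergent (\<lambda>n. vallee_poussin_mean lam n f x)"
    proof
      assume "convergent (\<lambda>n. vallee_poussin_mean lam n f x)"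
      then have "Cauchy (\<lambda>n. vallee_poussin_mean lam n f x)" by (rule convergent_Cauchy)
      then obtain j where j: "\<And>m n. j \<le> m \<Longrightarrow> j \<le> n \<Longrightarrow>
          \<bar>vallee_poussin_mean lam m f x - vallee_poussin_mean lam n f x\<bar> < 1"
        unfolding Cauchy_def dist_real_def by (metis zero_less_one)
      obtain p q where pq: "2 \<le> p" "p \<le> 2 ^ M j" "2 \<le> q" "q \<le> 2 ^ M j"
        and big: "2 ^ j \<le> \<bar>(\<Sum>i<p. c j i * walsh (2 ^ s j * i) x) - (\<Sum>i<q. c j i * walsh (2 ^ s j * i) x)\<bar>"
        using osc[OF signs_rademacher_shift, of j "s j" x] unfolding walsh_shift by blast
      have ge: "j \<le> 2 ^ s j * r" if "2 \<le> r" for r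
      proof -
        have "j \<le> 2 ^ s j" using js[of j] less_exp[of "s j"] by linarith
        also have "2 ^ s j * 1 \<le> 2 ^ s j * r" using that by (intro mult_le_mono2) simp
        finally show ?thesis by simp
      qed
      have "vallee_poussin_mean lam (2 ^ s j * p) f x - vallee_poussin_mean lam (2 ^ s j * q) f x
          = (1 / 2) ^ j * ((\<Sum>i<p. c j i * walsh (2 ^ s j * i) x) - (\<Sum>i<q. c j i * walsh (2 ^ s j * i) x))"
        unfolding VP[OF pq(1,2)] VP[OF pq(3,4)] by (simp add: algebra_simps)
      then have "(1 / 2) ^ j * \<bar>(\<Sum>i<p. c j i * walsh (2 ^ s j * i) x) - (\<Sum>i<q. c j i * walsh (2 ^ s j * i) x)\<bar> < 1"
        using j[OF ge[OF pq(1)] ge[OF pq(3)]] by (simp add: abs_mult)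
      moreover have "(1 / 2) ^ j * 2 ^ j \<le> (1 / 2 :: real) ^ j *
          \<bar>(\<Sum>i<p. c j i * walsh (2 ^ s j * i) x) - (\<Sum>i<q. c j i * walsh (2 ^ s j * i) x)\<bar>"
        using big by (intro mult_left_mono) auto
      moreover have "(1 / 2 :: real) ^ j * 2 ^ j = 1" by (simp flip: power_mult_distrib)
      ultimately show False by simp
    qed
  qed
qed

theorem theorem5:
  fixes lam :: "nat \<Rightarrow> nat"
  assumes "mono_on {1..} lam"
    and "\<And>n. n \<ge> 1 \<Longrightarrow> 1 \<le> lam n \<and> lam n \<le> n"
  shows "((\<lambda>n. real n) \<in> O(\<lambda>n. real (lam n)) \<longrightarrow>
            (\<forall>f :: real \<Rightarrow> real. integrable unit_measure f \<longrightarrow>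
              (AE x in unit_measure. (\<lambda>n. vallee_poussin_mean lam n f x) \<longlonglongrightarrow> f x)))
       \<and> (filterlim (\<lambda>n. real n / real (lam n)) at_top sequentially \<longrightarrow>
            (\<exists>f :: real \<Rightarrow> real. integrable unit_measure f \<and>
              (\<forall>x\<in>{0..<1}. \<not> convergent (\<lambda>n. vallee_poussin_mean lam n f x))))"
proof (intro conjI impI allI)
  fix f :: "real \<Rightarrow> real"
  assume "(\<lambda>n. real n) \<in> O(\<lambda>n. real (lam n))" and "integrable unit_measure f"
  then show "AE x in unit_measure. (\<lambda>n. vallee_poussin_mean lam n f x) \<longlonglongrightarrow> f x"
    using assms(2) by (intro AE_vallee_poussin_tendsto) auto
next
  assume "filterlim (\<lambda>n. real n / real (lam n)) at_top sequentially"
  then show "\<exists>f :: real \<Rightarrow> real. integrable unit_measure f \<and>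
      (\<forall>x\<in>{0..<1}. \<not> convergent (\<lambda>n. vallee_poussin_mean lam n f x))"
    using divergent_vallee_poussin[OF assms(2)] by metis
qed

end
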